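(* Let $p$ be a prime and $n\ge1$. For any $\mathbf{y}\in\mathbb{Q}_p^n$ we have $$w(\mathbf{y})=w_p(\mathbf{y})+1.$$
   Context: $\|\cdot\|_\infty$ and $\|\cdot\|_p$ denote the maxima of the real, respectively $p$-adic, absolute values of the coordinates. For $\mathbf{y}\in\mathbb{Q}_p^n$: $w(\mathbf{y})$ is the supremum of $v>0$ such that there are infinitely many $\tilde{\mathbf{q}}=(q_0,\mathbf{q})\in\mathbb{Z}\times\mathbb{Z}^n$ with $|q_0+\mathbf{q}\cdot\mathbf{y}|_p\le\|\tilde{\mathbf{q}}\|_\infty^{-v}$. $w_p(\mathbf{y})$ is the supremum of those $v$ for which there exist $\tilde{\mathbf{q}}=(q_0,\mathbf{q})\in\mathbb{Z}[1/p]\times\mathbb{Z}[1/p]^n$ with unbounded (i.e. arbitrarily large) $\|\mathbf{q}\|_p\|\tilde{\mathbf{q}}\|_\infty$ such that $$|\mathbf{q}\cdot\mathbf{y}+q_0|_p<\frac{1}{(\|\mathbf{q}\|_p\|\tilde{\mathbf{q}}\|_\infty)^{v}\,\|\tilde{\mathbf{q}}\|_\infty}.$$ Values may be $+\infty$, with $\infty+1=\infty$. *)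

theory Defs
  imports "HOL-Analysis.Analysis" "HOL-Algebra.QuotRing"
begin

section \<open>The $p$-adic absolute value on the rationals\<close>

definition rat_pval :: "nat \<Rightarrow> rat \<Rightarrow> int" where
  "rat_pval p x = (case quotient_of x of (a, b) \<Rightarrow>
     int (multiplicity (int p) a) - int (multiplicity (int p) b))"

definition rat_pabs :: "nat \<Rightarrow> rat \<Rightarrow> real" where
  "rat_pabs p x = (if x = 0 then 0 else real p powi (- rat_pval p x))"

section \<open>The field of $p$-adic numbers\<close>

text \<open>The $p$-adic numbers are the completion of the rationals with respect to \<^const>\<open>rat_pabs\<close>:
  the ring of Cauchy sequences modulo the ideal of null sequences.\<close>

definition pCauchy :: "nat \<Rightarrow> (nat \<Rightarrow> rat) \<Rightarrow> bool" where
  "pCauchy p x \<longleftrightarrow> (\<forall>e>0. \<exists>N. \<forall>m\<ge>N. \<forall>k\<ge>N. rat_pabs p (x m - x k) < e)"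

definition pCauchy_ring :: "nat \<Rightarrow> (nat \<Rightarrow> rat) ring" where
  "pCauchy_ring p =
     \<lparr>carrier = {x. pCauchy p x}, monoid.mult = (\<lambda>x y k. x k * y k), one = (\<lambda>_. 1),
      zero = (\<lambda>_. 0), add = (\<lambda>x y k. x k + y k)\<rparr>"

definition pnull :: "nat \<Rightarrow> (nat \<Rightarrow> rat) set" where
  "pnull p = {x. (\<lambda>k. rat_pabs p (x k)) \<longlonglongrightarrow> 0}"

type_synonym padic = "(nat \<Rightarrow> rat) set"

definition Qp :: "nat \<Rightarrow> padic ring" where
  "Qp p = pCauchy_ring p Quot pnull p"

definition Qp_of_rat :: "nat \<Rightarrow> rat \<Rightarrow> padic" where
  "Qp_of_rat p r = pnull p +>\<^bsub>pCauchy_ring p\<^esub> (\<lambda>_. r)"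

text \<open>All representatives of a class have the same limit of absolute values; see
  \<open>Qp_abs_coset\<close> below.\<close>

definition Qp_abs :: "nat \<Rightarrow> padic \<Rightarrow> real" where
  "Qp_abs p X = (THE r. \<forall>x\<in>X. (\<lambda>k. rat_pabs p (x k)) \<longlonglongrightarrow> r)"

lemma rat_pabs_quot:
  assumes "prime p" "a \<noteq> 0" "b \<noteq> 0"
  shows "rat_pabs p (of_int a / of_int b)
    = real p powi (int (multiplicity (int p) b) - int (multiplicity (int p) a))"
proof -
  obtain c d where cd: "quotient_of (of_int a / of_int b) = (c, d)" by force
  have d: "d > 0" by (rule quotient_of_denom_pos[OF cd])
  have eq: "of_int a / of_int b = (of_int c / of_int d :: rat)" by (rule quotient_of_div[OF cd])
  have c: "c \<noteq> 0" using eq assms d by auto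
  have "of_int (a * d) = (of_int (c * b) :: rat)" using eq assms d by (simp add: field_simps)
  hence "a * d = c * b" by (simp only: of_int_eq_iff)
  moreover have pe: "prime_elem (int p)" using assms by simp
  ultimately have "multiplicity (int p) a + multiplicity (int p) d
      = multiplicity (int p) c + multiplicity (int p) b"
    using assms c d by (metis order_less_irrefl prime_elem_multiplicity_mult_distrib)
  moreover have "of_int a / (of_int b :: rat) \<noteq> 0" using assms by simp
  moreover have "int (multiplicity (int p) d) - int (multiplicity (int p) c)
      = int (multiplicity (int p) b) - int (multiplicity (int p) a)"
    using calculation(1) by linarith
  ultimately show ?thesis using cd by (simp add: rat_pabs_def rat_pval_def)
qed

lemma rat_pabs_0 [simp]: "rat_pabs p 0 = 0"
  by (simp add: rat_pabs_def)

lemma rat_pabs_nonneg [simp]: "rat_pabs p x \<ge> 0"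
  by (simp add: rat_pabs_def)

lemma rat_pabs_eq_0_iff:
  assumes "prime p" shows "rat_pabs p x = 0 \<longleftrightarrow> x = 0"
  using prime_gt_0_nat[OF assms] by (simp add: rat_pabs_def)

lemma rat_frac: obtains a b where "x = of_int a / (of_int b :: rat)" "b \<noteq> 0"
  using quotient_of_div quotient_of_denom_pos by (metis less_irrefl surj_pair)

lemma rat_pabs_mult:
  assumes "prime p" shows "rat_pabs p (x * y) = rat_pabs p x * rat_pabs p y"
proof (cases "x = 0 \<or> y = 0")
  case False
  obtain a b where x: "x = of_int a / (of_int b :: rat)" "b \<noteq> 0" by (rule rat_frac)
  obtain c d where y: "y = of_int c / (of_int d :: rat)" "d \<noteq> 0" by (rule rat_frac)
  have ac: "a \<noteq> 0" "c \<noteq> 0" using False x y by auto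
  have xy: "x * y = of_int (a * c) / of_int (b * d)" using x y by simp
  have pe: "prime_elem (int p)" and p0: "real p \<noteq> 0" using assms prime_gt_0_nat[OF assms] by auto
  show ?thesis unfolding xy unfolding x(1) y(1) using assms x y ac p0
    by (simp only: rat_pabs_quot mult_eq_0_iff prime_elem_multiplicity_mult_distrib[OF pe] simp_thms)
      (simp add: power_int_add[symmetric] algebra_simps)
qed auto

lemma rat_pabs_1 [simp]: "prime p \<Longrightarrow> rat_pabs p 1 = 1"
  using rat_pabs_quot[of p 1 1] by simp

lemma rat_pabs_minus [simp]: "rat_pabs p (- x) = rat_pabs p x"
proof -
  obtain a b where "quotient_of x = (a, b)" by force
  moreover have "multiplicity (int p) (- a) = multiplicity (int p) a"
    by (simp add: multiplicity_def)
  ultimately show ?thesis by (simp add: rat_pabs_def rat_pval_def rat_uminus_code)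
qed

lemma rat_pabs_diff_commute: "rat_pabs p (x - y) = rat_pabs p (y - x)"
  using rat_pabs_minus[of p "x - y"] by simp

lemma rat_pabs_add_le_max:
  assumes "prime p" shows "rat_pabs p (x + y) \<le> max (rat_pabs p x) (rat_pabs p y)"
proof (cases "x = 0 \<or> y = 0 \<or> x + y = 0")
  case False
  obtain a' b where x': "x = of_int a' / (of_int b :: rat)" "b \<noteq> 0" by (rule rat_frac)
  obtain c' d where y': "y = of_int c' / (of_int d :: rat)" "d \<noteq> 0" by (rule rat_frac)
  define a where "a = a' * d"
  define c where "c = c' * b"
  define e where "e = b * d"
  have x: "x = of_int a / of_int e" and y: "y = of_int c / of_int e" and e: "e \<noteq> 0"
    using x' y' by (auto simp: a_def c_def e_def)
  have xy: "x + y = of_int (a + c) / of_int e" by (simp add: x y add_divide_distrib)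
  have nz: "a \<noteq> 0" "c \<noteq> 0" "a + c \<noteq> 0"
    using False x y xy by (metis div_0 of_int_0)+
  have p1: "real p > 1" using prime_gt_1_nat[OF assms] by simp
  let ?m = "multiplicity (int p)"
  have "int p ^ min (?m a) (?m c) dvd a + c"
    by (rule dvd_add[OF multiplicity_dvd'[OF min.cobounded1] multiplicity_dvd'[OF min.cobounded2]])
  hence le: "min (?m a) (?m c) \<le> ?m (a + c)"
    using nz(3) assms by (subst (asm) power_dvd_iff_le_multiplicity) auto
  have "rat_pabs p (x + y) = real p powi (int (?m e) - int (?m (a + c)))"
    unfolding xy by (rule rat_pabs_quot[OF assms nz(3) e])
  moreover have "rat_pabs p x = real p powi (int (?m e) - int (?m a))"
    unfolding x by (rule rat_pabs_quot[OF assms nz(1) e])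
  moreover have "rat_pabs p y = real p powi (int (?m e) - int (?m c))"
    unfolding y by (rule rat_pabs_quot[OF assms nz(2) e])
  moreover have "?m a \<le> ?m (a + c) \<or> ?m c \<le> ?m (a + c)" using le by linarith
  hence "real p powi (int (?m e) - int (?m (a + c))) \<le> real p powi (int (?m e) - int (?m a))
      \<or> real p powi (int (?m e) - int (?m (a + c))) \<le> real p powi (int (?m e) - int (?m c))"
  proof
    assume "?m a \<le> ?m (a + c)"
    hence "int (?m e) - int (?m (a + c)) \<le> int (?m e) - int (?m a)" by linarith
    thus ?thesis using power_int_increasing less_imp_le[OF p1] by blast
  next
    assume "?m c \<le> ?m (a + c)"
    hence "int (?m e) - int (?m (a + c)) \<le> int (?m e) - int (?m c)" by linarith
    thus ?thesis using power_int_increasing less_imp_le[OF p1] by blast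
  qed
  ultimately show ?thesis by (simp only: le_max_iff_disj)
next
  case True
  then consider "x = 0" | "y = 0" | "x + y = 0" by blast
  thus ?thesis by cases (simp_all add: le_max_iff_disj)
qed

lemma rat_pabs_triangle:
  assumes "prime p" shows "rat_pabs p (x + y) \<le> rat_pabs p x + rat_pabs p y"
  using rat_pabs_add_le_max[OF assms, of x y] rat_pabs_nonneg[of p x] rat_pabs_nonneg[of p y]
  by linarith

lemma rat_pabs_reverse_triangle:
  assumes "prime p" shows "\<bar>rat_pabs p x - rat_pabs p y\<bar> \<le> rat_pabs p (x - y)"
  using rat_pabs_triangle[OF assms, of "x - y" y] rat_pabs_triangle[OF assms, of "y - x" x]
  by (simp add: rat_pabs_diff_commute[of p y x])

lemma pCauchy_convergent:
  assumes "prime p" "pCauchy p x" shows "convergent (\<lambda>k. rat_pabs p (x k))"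
proof (intro real_Cauchy_convergent CauchyI)
  fix e :: real assume "e > 0"
  then obtain N where "\<forall>m\<ge>N. \<forall>k\<ge>N. rat_pabs p (x m - x k) < e"
    using assms(2) by (auto simp: pCauchy_def)
  hence "\<forall>m\<ge>N. \<forall>k\<ge>N. norm (rat_pabs p (x m) - rat_pabs p (x k)) < e"
    using rat_pabs_reverse_triangle[OF assms(1)] by (metis order_le_less_trans real_norm_def)
  thus "\<exists>M. \<forall>m\<ge>M. \<forall>n\<ge>M. norm (rat_pabs p (x m) - rat_pabs p (x n)) < e" by blast
qed

lemma pCauchy_bounded:
  assumes "prime p" "pCauchy p x" obtains C where "C > 0" "\<And>k. rat_pabs p (x k) \<le> C"
proof -
  have "Bseq (\<lambda>k. rat_pabs p (x k))"
    by (intro convergent_imp_Bseq pCauchy_convergent assms)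
  thus ?thesis using that by (auto simp: Bseq_def)
qed

lemma pCauchy_const [simp]: "pCauchy p (\<lambda>_. r)"
  by (simp add: pCauchy_def)

lemma pCauchy_minus: "pCauchy p x \<Longrightarrow> pCauchy p (\<lambda>k. - x k)"
  by (simp add: pCauchy_def) (metis rat_pabs_diff_commute)

lemma pCauchy_add:
  assumes "prime p" "pCauchy p x" "pCauchy p y" shows "pCauchy p (\<lambda>k. x k + y k)"
  unfolding pCauchy_def
proof (intro allI impI)
  fix e :: real assume e: "e > 0"
  obtain N where N: "\<forall>m\<ge>N. \<forall>k\<ge>N. rat_pabs p (x m - x k) < e"
    using assms(2) e by (auto simp: pCauchy_def)
  obtain M where M: "\<forall>m\<ge>M. \<forall>k\<ge>M. rat_pabs p (y m - y k) < e"
    using assms(3) e by (auto simp: pCauchy_def)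
  have "rat_pabs p (x m + y m - (x k + y k)) < e" if "m \<ge> max N M" "k \<ge> max N M" for m k
  proof -
    have "x m + y m - (x k + y k) = (x m - x k) + (y m - y k)" by simp
    moreover have "max (rat_pabs p (x m - x k)) (rat_pabs p (y m - y k)) < e" using N M that by simp
    ultimately show ?thesis using rat_pabs_add_le_max[OF assms(1)] by (metis order_le_less_trans)
  qed
  thus "\<exists>N. \<forall>m\<ge>N. \<forall>k\<ge>N. rat_pabs p (x m + y m - (x k + y k)) < e" by blast
qed

lemma pCauchy_mult:
  assumes "prime p" "pCauchy p x" "pCauchy p y" shows "pCauchy p (\<lambda>k. x k * y k)"
  unfolding pCauchy_def
proof (intro allI impI)
  fix e :: real assume e: "e > 0"
  obtain C where C: "C > 0" "\<And>k. rat_pabs p (x k) \<le> C" using pCauchy_bounded[OF assms(1,2)] by blast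
  obtain D where D: "D > 0" "\<And>k. rat_pabs p (y k) \<le> D" using pCauchy_bounded[OF assms(1,3)] by blast
  obtain N where N: "\<forall>m\<ge>N. \<forall>k\<ge>N. rat_pabs p (x m - x k) < e / D"
    using assms(2) divide_pos_pos[OF e D(1)] unfolding pCauchy_def by blast
  obtain M where M: "\<forall>m\<ge>M. \<forall>k\<ge>M. rat_pabs p (y m - y k) < e / C"
    using assms(3) divide_pos_pos[OF e C(1)] unfolding pCauchy_def by blast
  have "rat_pabs p (x m * y m - x k * y k) < e" if mk: "m \<ge> max N M" "k \<ge> max N M" for m k
  proof -
    have eq: "x m * y m - x k * y k = x m * (y m - y k) + (x m - x k) * y k"
      by (simp add: algebra_simps)
    have "rat_pabs p (x m * (y m - y k)) \<le> C * rat_pabs p (y m - y k)"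
      unfolding rat_pabs_mult[OF assms(1)] using C by (intro mult_right_mono) auto
    also have "\<dots> < e" using M mk C by (auto simp: field_simps)
    finally have 1: "rat_pabs p (x m * (y m - y k)) < e" .
    have "rat_pabs p ((x m - x k) * y k) \<le> rat_pabs p (x m - x k) * D"
      unfolding rat_pabs_mult[OF assms(1)] using D by (intro mult_left_mono) auto
    also have "\<dots> < e" using N mk D by (auto simp: field_simps)
    finally have 2: "rat_pabs p ((x m - x k) * y k) < e" .
    show ?thesis unfolding eq using rat_pabs_add_le_max[OF assms(1)] 1 2
      by (smt (verit) max_def)
  qed
  thus "\<exists>N. \<forall>m\<ge>N. \<forall>k\<ge>N. rat_pabs p (x m * y m - x k * y k) < e" by blast
qed

lemma pCauchy_ring_simps [simp]:
  "x \<in> carrier (pCauchy_ring p) \<longleftrightarrow> pCauchy p x"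
  "x \<otimes>\<^bsub>pCauchy_ring p\<^esub> y = (\<lambda>k. x k * y k)"
  "x \<oplus>\<^bsub>pCauchy_ring p\<^esub> y = (\<lambda>k. x k + y k)"
  "\<zero>\<^bsub>pCauchy_ring p\<^esub> = (\<lambda>_. 0)"
  "\<one>\<^bsub>pCauchy_ring p\<^esub> = (\<lambda>_. 1)"
  by (simp_all add: pCauchy_ring_def)

lemma pCauchy_cring:
  assumes "prime p" shows "cring (pCauchy_ring p)"
proof (rule cringI)
  show "abelian_group (pCauchy_ring p)"
  proof (rule abelian_groupI)
    fix x assume "x \<in> carrier (pCauchy_ring p)"
    thus "\<exists>y\<in>carrier (pCauchy_ring p). y \<oplus>\<^bsub>pCauchy_ring p\<^esub> x = \<zero>\<^bsub>pCauchy_ring p\<^esub>"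
      by (intro bexI[of _ "\<lambda>k. - x k"]) (simp_all add: pCauchy_minus)
  qed (simp_all add: pCauchy_add[OF assms] add.assoc, simp add: add.commute)
  show "comm_monoid (pCauchy_ring p)"
    by (rule comm_monoidI, simp_all add: pCauchy_mult[OF assms] mult.assoc, simp add: mult.commute)
qed (simp add: distrib_right)

lemma pnull_pCauchy:
  assumes "prime p" "x \<in> pnull p" shows "pCauchy p x"
  unfolding pCauchy_def
proof (intro allI impI)
  fix e :: real assume "e > 0"
  then obtain N where N: "\<forall>k\<ge>N. rat_pabs p (x k) < e"
    using assms(2) LIMSEQ_D[of "\<lambda>k. rat_pabs p (x k)" 0 e] by (auto simp: pnull_def)
  have "rat_pabs p (x m - x k) < e" if "m \<ge> N" "k \<ge> N" for m k
    using rat_pabs_add_le_max[OF assms(1), of "x m" "- x k"] N that by (smt (verit) max_def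
      rat_pabs_minus add_uminus_conv_diff)
  thus "\<exists>N. \<forall>m\<ge>N. \<forall>k\<ge>N. rat_pabs p (x m - x k) < e" by blast
qed

lemma pnull_add:
  assumes "prime p" "x \<in> pnull p" "y \<in> pnull p" shows "(\<lambda>k. x k + y k) \<in> pnull p"
proof -
  have "(\<lambda>k. rat_pabs p (x k) + rat_pabs p (y k)) \<longlonglongrightarrow> 0"
    using tendsto_add[of "\<lambda>k. rat_pabs p (x k)" 0 sequentially "\<lambda>k. rat_pabs p (y k)" 0] assms(2,3)
    by (simp add: pnull_def)
  thus ?thesis unfolding pnull_def mem_Collect_eq
    by (rule tendsto_sandwich[rotated 3, where f = "\<lambda>_. 0"])
      (simp_all add: rat_pabs_triangle[OF assms(1)])
qed

lemma pnull_mult: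
  assumes "prime p" "x \<in> pnull p" "pCauchy p y" shows "(\<lambda>k. x k * y k) \<in> pnull p"
proof -
  obtain L where "(\<lambda>k. rat_pabs p (y k)) \<longlonglongrightarrow> L"
    using pCauchy_convergent[OF assms(1,3)] by (auto simp: convergent_def)
  from tendsto_mult[OF _ this, of "\<lambda>k. rat_pabs p (x k)" 0] assms(2) show ?thesis
    by (simp add: pnull_def rat_pabs_mult[OF assms(1)])
qed

lemma pnull_ideal:
  assumes "prime p" shows "ideal (pnull p) (pCauchy_ring p)"
proof -
  interpret cring "pCauchy_ring p" by (rule pCauchy_cring[OF assms])
  have inv: "\<ominus>\<^bsub>pCauchy_ring p\<^esub> x = (\<lambda>k. - x k)" if "pCauchy p x" for x
    by (rule minus_equality) (use that in \<open>simp_all add: pCauchy_minus\<close>)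
  show ?thesis
  proof (rule idealI)
    show "subgroup (pnull p) (add_monoid (pCauchy_ring p))"
    proof (rule add.subgroupI)
      show "pnull p \<noteq> {}" by (auto simp: pnull_def intro!: exI[of _ "\<lambda>_. 0"])
    next
      fix x assume x: "x \<in> pnull p"
      show "\<ominus>\<^bsub>pCauchy_ring p\<^esub> x \<in> pnull p"
        using x inv[OF pnull_pCauchy[OF assms x]] by (simp add: pnull_def)
    qed (auto simp: pnull_pCauchy[OF assms] pnull_add[OF assms])
  next
    fix a x assume "a \<in> pnull p" "x \<in> carrier (pCauchy_ring p)"
    thus "x \<otimes>\<^bsub>pCauchy_ring p\<^esub> a \<in> pnull p" "a \<otimes>\<^bsub>pCauchy_ring p\<^esub> x \<in> pnull p"
      using pnull_mult[OF assms, of a x] by (simp add: mult.commute[of "x _"], simp)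
  qed (rule ring_axioms)
qed

lemma Qp_coset: "z \<in> pnull p +>\<^bsub>pCauchy_ring p\<^esub> x \<longleftrightarrow> (\<exists>h\<in>pnull p. z = (\<lambda>k. h k + x k))"
  unfolding a_r_coset_def' by simp

lemma Qp_abs_coset:
  assumes "prime p" "pCauchy p x"
  shows "(\<lambda>k. rat_pabs p (x k)) \<longlonglongrightarrow> Qp_abs p (pnull p +>\<^bsub>pCauchy_ring p\<^esub> x)"
proof -
  let ?X = "pnull p +>\<^bsub>pCauchy_ring p\<^esub> x"
  obtain L where L: "(\<lambda>k. rat_pabs p (x k)) \<longlonglongrightarrow> L"
    using pCauchy_convergent[OF assms] by (auto simp: convergent_def)
  have "(\<lambda>k. rat_pabs p (z k)) \<longlonglongrightarrow> L" if "z \<in> ?X" for z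
  proof -
    from that obtain h where h: "h \<in> pnull p" and z: "z = (\<lambda>k. h k + x k)"
      unfolding Qp_coset by blast
    have "z k - x k = h k" for k by (simp add: z)
    hence "norm (rat_pabs p (z k) - rat_pabs p (x k)) \<le> rat_pabs p (h k)" for k
      using rat_pabs_reverse_triangle[OF assms(1), of "z k" "x k"] by (metis real_norm_def)
    moreover have "(\<lambda>k. rat_pabs p (h k)) \<longlonglongrightarrow> 0" using h by (simp add: pnull_def)
    ultimately have "(\<lambda>k. rat_pabs p (z k) - rat_pabs p (x k)) \<longlonglongrightarrow> 0"
      by (rule Lim_null_comparison[OF always_eventually[OF allI]])
    from tendsto_add[OF this L] show ?thesis by simp
  qed
  hence all: "\<forall>z\<in>?X. (\<lambda>k. rat_pabs p (z k)) \<longlonglongrightarrow> L" by blast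
  have "(\<lambda>_. 0) \<in> pnull p" by (simp add: pnull_def)
  hence x: "x \<in> ?X" unfolding Qp_coset by (rule bexI[rotated]) simp
  have "Qp_abs p ?X = L" unfolding Qp_abs_def
  proof (rule the_equality)
    show "\<forall>z\<in>?X. (\<lambda>k. rat_pabs p (z k)) \<longlonglongrightarrow> L" by (rule all)
  next
    fix r assume "\<forall>z\<in>?X. (\<lambda>k. rat_pabs p (z k)) \<longlonglongrightarrow> r"
    hence "(\<lambda>k. rat_pabs p (x k)) \<longlonglongrightarrow> r" using x by (rule bspec)
    thus "r = L" using L by (rule LIMSEQ_unique)
  qed
  thus ?thesis using L by simp
qed

lemma Qp_abs_of_rat: "prime p \<Longrightarrow> Qp_abs p (Qp_of_rat p r) = rat_pabs p r"
  unfolding Qp_of_rat_def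
  by (rule LIMSEQ_unique[OF Qp_abs_coset[OF _ pCauchy_const] tendsto_const])

lemma pCauchy_inverse:
  assumes "prime p" "pCauchy p x" "x \<notin> pnull p"
  shows "pCauchy p (\<lambda>k. inverse (x k))" "\<exists>N. \<forall>k\<ge>N. x k \<noteq> 0"
proof -
  obtain L where L: "(\<lambda>k. rat_pabs p (x k)) \<longlonglongrightarrow> L"
    using pCauchy_convergent[OF assms(1,2)] by (auto simp: convergent_def)
  have "L \<noteq> 0" using L assms(3) by (auto simp: pnull_def)
  moreover have "L \<ge> 0" using L by (rule LIMSEQ_le_const) auto
  ultimately have L0: "L > 0" by simp
  have "eventually (\<lambda>k. rat_pabs p (x k) > L / 2) sequentially"
    using L L0 by (intro order_tendstoD(1)) auto
  then obtain N where N: "\<forall>k\<ge>N. rat_pabs p (x k) > L / 2" by (auto simp: eventually_sequentially)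
  have nz: "x k \<noteq> 0" if "k \<ge> N" for k using N that L0 by (metis rat_pabs_0 half_gt_zero less_asym)
  show "\<exists>N. \<forall>k\<ge>N. x k \<noteq> 0" using nz by blast
  show "pCauchy p (\<lambda>k. inverse (x k))" unfolding pCauchy_def
  proof (intro allI impI)
    fix e :: real assume e: "e > 0"
    have "e * (L / 2)\<^sup>2 > 0" using e L0 by simp
    then obtain M where M: "\<forall>m\<ge>M. \<forall>k\<ge>M. rat_pabs p (x m - x k) < e * (L / 2)\<^sup>2"
      using assms(2) unfolding pCauchy_def by blast
    have "rat_pabs p (inverse (x m) - inverse (x k)) < e" if mk: "m \<ge> max N M" "k \<ge> max N M" for m k
    proof -
      have nz': "x m \<noteq> 0" "x k \<noteq> 0" using nz mk by auto
      have "x k - x m = (inverse (x m) - inverse (x k)) * (x m * x k)"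
        using nz' by (simp add: field_simps)
      hence "rat_pabs p (x m - x k)
          = rat_pabs p (inverse (x m) - inverse (x k)) * (rat_pabs p (x m) * rat_pabs p (x k))"
        by (metis rat_pabs_mult[OF assms(1)] rat_pabs_diff_commute)
      also have "\<dots> \<ge> rat_pabs p (inverse (x m) - inverse (x k)) * (L / 2)\<^sup>2"
        unfolding power2_eq_square using N mk L0 by (intro mult_left_mono mult_mono) (auto simp: less_imp_le)
      finally have "rat_pabs p (inverse (x m) - inverse (x k)) * (L / 2)\<^sup>2 < e * (L / 2)\<^sup>2"
        using M mk by fastforce
      thus ?thesis using L0 by (simp add: mult_less_cancel_right)
    qed
    thus "\<exists>N. \<forall>m\<ge>N. \<forall>k\<ge>N. rat_pabs p (inverse (x m) - inverse (x k)) < e" by blast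
  qed
qed

lemma Qp_field:
  assumes "prime p" shows "field (Qp p)"
proof -
  let ?R = "pCauchy_ring p"
  interpret R: cring ?R by (rule pCauchy_cring[OF assms])
  have one: "\<one>\<^bsub>?R\<^esub> \<notin> pnull p"
    using LIMSEQ_unique[OF tendsto_const, of "1 :: real" 0] assms by (auto simp: pnull_def)
  have "maximalideal (pnull p) ?R"
  proof (rule maximalidealI[OF pnull_ideal[OF assms]])
    show "carrier ?R \<noteq> pnull p" using one R.one_closed by metis
  next
    fix J assume J: "ideal J ?R" "pnull p \<subseteq> J" "J \<subseteq> carrier ?R"
    interpret J: ideal J ?R by (rule J(1))
    show "J = pnull p \<or> J = carrier ?R"
    proof (cases "J = pnull p")
      case False
      then obtain x where x: "x \<in> J" "x \<notin> pnull p" using J by blast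
      have "x \<in> carrier ?R" using x(1) J(3) by (rule subsetD[rotated])
      hence Cx: "pCauchy p x" by (simp only: pCauchy_ring_simps)
      note i = pCauchy_inverse[OF assms Cx x(2)]
      obtain N where N: "\<forall>k\<ge>N. x k \<noteq> 0" using i(2) by blast
      define y where "y = (\<lambda>k. inverse (x k))"
      define z where "z = (\<lambda>k. 1 - x k * y k)"
      have "y \<in> carrier ?R" using i(1) by (simp only: pCauchy_ring_simps y_def)
      with x(1) have xy: "x \<otimes>\<^bsub>?R\<^esub> y \<in> J" by (rule J.I_r_closed)
      have "z k = 0" if "k \<ge> N" for k using N that by (simp add: z_def y_def)
      hence "eventually (\<lambda>k. rat_pabs p (z k) = 0) sequentially"
        unfolding eventually_sequentially by (metis rat_pabs_0)
      hence "z \<in> pnull p" unfolding pnull_def mem_Collect_eq by (rule tendsto_eventually)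
      hence "z \<in> J" using J(2) by (rule subsetD[rotated])
      hence "z \<oplus>\<^bsub>?R\<^esub> (x \<otimes>\<^bsub>?R\<^esub> y) \<in> J" using xy by (rule J.a_closed)
      moreover have "z \<oplus>\<^bsub>?R\<^esub> (x \<otimes>\<^bsub>?R\<^esub> y) = \<one>\<^bsub>?R\<^esub>" by (simp add: z_def)
      ultimately have "\<one>\<^bsub>?R\<^esub> \<in> J" by (simp only:)
      thus ?thesis using J.one_imp_carrier by blast
    qed simp
  qed
  thus ?thesis unfolding Qp_def by (rule maximalideal.quotient_is_field[OF _ R.is_cring])
qed

section \<open>The exponents $w$ and $w_p$\<close>

definition Z_inv :: "nat \<Rightarrow> rat set" where
  "Z_inv p = {of_int a / of_nat p ^ k | a k. True}"

text \<open>The maximum norms of $\mathbf q$ and of $(q_0,\mathbf q)$.\<close>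

definition pmax :: "nat \<Rightarrow> rat ^ 'n \<Rightarrow> real" where
  "pmax p q = Max (range (\<lambda>i. rat_pabs p (q $ i)))"

definition supmax :: "rat \<Rightarrow> rat ^ 'n \<Rightarrow> real" where
  "supmax q0 q = Max (insert \<bar>real_of_rat q0\<bar> (range (\<lambda>i. \<bar>real_of_rat (q $ i)\<bar>)))"

definition Qp_form :: "nat \<Rightarrow> rat \<Rightarrow> rat ^ 'n \<Rightarrow> padic ^ 'n \<Rightarrow> padic" where
  "Qp_form p q0 q y =
     Qp_of_rat p q0 \<oplus>\<^bsub>Qp p\<^esub>
       (\<Oplus>\<^bsub>Qp p\<^esub> i\<in>UNIV. Qp_of_rat p (q $ i) \<otimes>\<^bsub>Qp p\<^esub> (y $ i))"

text \<open>The suprema are taken in the extended reals. As \<open>0 powr a = 0\<close>, the zero vector satisfies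
  the inequality below, which does not affect whether there are infinitely many solutions.\<close>

definition w_exp :: "nat \<Rightarrow> padic ^ 'n \<Rightarrow> ereal" where
  "w_exp p y = Sup {ereal v | v. v > 0 \<and>
     infinite {(q0 :: int, q :: int ^ 'n).
       Qp_abs p (Qp_form p (of_int q0) (\<chi> i. of_int (q $ i)) y)
         \<le> supmax (of_int q0) (\<chi> i. of_int (q $ i)) powr (- v)}}"

definition wp_exp :: "nat \<Rightarrow> padic ^ 'n \<Rightarrow> ereal" where
  "wp_exp p y = Sup {ereal v | v.
     \<forall>B :: real. \<exists>q0\<in>Z_inv p. \<exists>q :: rat ^ 'n. (\<forall>i. q $ i \<in> Z_inv p) \<and>
       pmax p q * supmax q0 q > B \<and>
       Qp_abs p (Qp_form p q0 q y)
         < 1 / ((pmax p q * supmax q0 q) powr v * supmax q0 q)}"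

end

theory Submission
  imports Defs "HOL-Number_Theory.Cong"
begin

text \<open>The quantity \<open>pmax q * supmax (q0, q)\<close> is invariant under scaling by powers of
  \<open>p\<close>, and so is the product of \<open>supmax\<close> with the absolute value of the linear form.
  Scaling by the power \<open>pmax q\<close> of \<open>p\<close>, times a fixed power that absorbs the denominators
  of \<open>y\<close>, turns a solution over \<open>\<int>[1/p]\<close> with exponent \<open>v\<close> into an
  integral one with exponent \<open>v + 1\<close>, up to a constant. Conversely, an integral solution with exponent
  \<open>v > 1\<close> is itself a solution over \<open>\<int>[1/p]\<close> with exponent \<open>v - 1\<close>,
  because \<open>pmax q \<le> 1\<close>; only the unboundedness of \<open>pmax q * supmax (q0, q)\<close> is at
  issue. It fails at most if an integral form vanishes at \<open>y\<close>, and then the multiples of that form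
  prime to \<open>p\<close> show that the exponent over \<open>\<int>[1/p]\<close> is infinite. Exponents \<open>v
  \<le> 1\<close> are covered by \<open>w \<ge> 1\<close>, seen from \<open>(p ^ k, 0)\<close>, and by
  \<open>w\<^sub>p \<ge> 0\<close>, seen from the approximations of one coordinate of \<open>y\<close> by elements
  of \<open>\<int>[1/p]\<close> between \<open>p ^ k\<close> and \<open>2 * p ^ k\<close>.\<close>

section \<open>The \<open>p\<close>-adic absolute value on \<open>\<int>[1/p]\<close>\<close>

lemma rat_pabs_of_int:
  assumes "prime p" "a \<noteq> 0"
  shows "rat_pabs p (of_int a) = real p powi (- int (multiplicity (int p) a))"
  using rat_pabs_quot[OF assms, of 1] by simp

lemma rat_pabs_of_int_le_1:
  assumes "prime p"
  shows "rat_pabs p (of_int a) \<le> 1"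
proof (cases "a = 0")
  case False
  then show ?thesis
    using prime_gt_1_nat[OF assms]
    by (simp add: rat_pabs_of_int[OF assms] power_int_minus field_simps one_le_power)
qed simp

text \<open>The p-part of a nonzero integer divides it, so it is at most the real size; the p-adic
  absolute value is the inverse of that p-part.\<close>

lemma rat_pabs_of_int_times_abs_ge_1:
  assumes "prime p" "a \<noteq> 0"
  shows "1 \<le> rat_pabs p (of_int a) * \<bar>of_int a\<bar>"
proof -
  let ?m = "multiplicity (int p) a"
  have "int p ^ ?m dvd a" by (rule multiplicity_dvd)
  then have "int p ^ ?m \<le> \<bar>a\<bar>" using dvd_imp_le_int[OF assms(2), of "int p ^ ?m"] by simp
  then have "real p ^ ?m \<le> \<bar>real_of_int a\<bar>"
    by (metis of_int_abs of_int_le_iff of_int_of_nat_eq of_int_power)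
  moreover have "real p ^ ?m > 0" using prime_gt_0_nat[OF assms(1)] by simp
  ultimately show ?thesis
    by (simp add: rat_pabs_of_int[OF assms] power_int_minus field_simps)
qed

lemma rat_pabs_of_int_le_power:
  assumes "prime p" "int p ^ k dvd a"
  shows "rat_pabs p (of_int a) \<le> inverse (real p ^ k)"
proof (cases "a = 0")
  case False
  have "k \<le> multiplicity (int p) a"
    using assms False by (subst power_dvd_iff_le_multiplicity[symmetric]) auto
  then have "real p ^ k \<le> real p ^ multiplicity (int p) a"
    using prime_gt_0_nat[OF assms(1)] by (intro power_increasing) auto
  then show ?thesis
    using prime_gt_0_nat[OF assms(1)]
    by (simp add: rat_pabs_of_int[OF assms(1) False] power_int_minus le_imp_inverse_le)
qed simp

lemma rat_pabs_of_int_eq_1: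
  assumes "prime p" "\<not> int p dvd a"
  shows "rat_pabs p (of_int a) = 1"
  using assms by (subst rat_pabs_of_int) (auto simp: not_dvd_imp_multiplicity_0)

lemma rat_pabs_inverse:
  assumes "prime p"
  shows "rat_pabs p (inverse x) = inverse (rat_pabs p x)"
proof (cases "x = 0")
  case False
  then have "rat_pabs p x * rat_pabs p (inverse x) = 1"
    using assms by (simp flip: rat_pabs_mult)
  then show ?thesis by (simp add: inverse_unique)
qed simp

lemma rat_pabs_divide:
  assumes "prime p"
  shows "rat_pabs p (x / y) = rat_pabs p x / rat_pabs p y"
  by (simp add: divide_inverse rat_pabs_mult rat_pabs_inverse assms)

lemma rat_pabs_p:
  assumes "prime p"
  shows "rat_pabs p (of_nat p) = inverse (real p)"
  using rat_pabs_of_int[OF assms, of "int p"] assms prime_gt_0_nat[OF assms]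
  by (simp add: power_int_minus)

lemma rat_pabs_power:
  assumes "prime p"
  shows "rat_pabs p (x ^ k) = rat_pabs p x ^ k"
  by (induction k) (simp_all add: assms rat_pabs_mult)

lemma rat_pabs_p_powi:
  assumes "prime p"
  shows "rat_pabs p (of_nat p powi t) = real p powi (- t)"
  using prime_gt_0_nat[OF assms]
  by (cases t) (auto simp: power_int_minus rat_pabs_power rat_pabs_inverse rat_pabs_p assms
      power_inverse power_int_def)

lemma of_rat_p_powi: "of_rat (of_nat p powi t) = (of_nat p powi t :: 'a :: field_char_0)"
  by (simp add: power_int_def of_rat_power of_rat_inverse)

text \<open>The value group is discrete, so a positive \<open>pmax\<close> is a power of
  \<open>p\<close> and vectors can be rescaled by exactly that power.\<close>

lemma rat_pabs_range:
  assumes "rat_pabs p x \<noteq> 0"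
  obtains t where "rat_pabs p x = real p powi t"
  using assms that unfolding rat_pabs_def by (auto split: if_splits)

lemma rat_pabs_sum_le:
  assumes "prime p" "C \<ge> 0" "\<And>i. i \<in> A \<Longrightarrow> rat_pabs p (f i) \<le> C"
  shows "rat_pabs p (sum f A) \<le> C"
  using assms(3)
proof (induction A rule: infinite_finite_induct)
  case (insert a A)
  then show ?case
    using rat_pabs_add_le_max[OF assms(1), of "f a" "sum f A"] by fastforce
qed (use assms(2) in auto)

section \<open>Elements of Z[1/p]: integrality and approximation\<close>

lemma Z_inv_of_int [simp]: "of_int a \<in> Z_inv p"
  unfolding Z_inv_def by (auto intro!: exI[of _ a] exI[of _ "0 :: nat"])

lemma Z_inv_mult:
  assumes "a \<in> Z_inv p" "b \<in> Z_inv p"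
  shows "a * b \<in> Z_inv p"
proof -
  obtain c k d l where "a = of_int c / of_nat p ^ k" "b = of_int d / of_nat p ^ l"
    using assms unfolding Z_inv_def by blast
  then have "a * b = of_int (c * d) / of_nat p ^ (k + l)" by (simp add: power_add)
  then show ?thesis unfolding Z_inv_def by blast
qed

lemma Z_inv_p_powi: "of_nat p powi t \<in> Z_inv p"
proof (cases "t \<ge> 0")
  case True
  then have "of_nat p powi t = (of_int (int p ^ nat t) :: rat)" by (simp add: power_int_def)
  then show ?thesis by (metis Z_inv_of_int)
next
  case False
  then have "of_nat p powi t = (of_int 1 / of_nat p ^ nat (- t) :: rat)"
    by (simp add: power_int_def power_inverse field_simps)
  then show ?thesis unfolding Z_inv_def by blast
qed

text \<open>The denominator is a power of \<open>p\<close>, and absolute value at most 1 forces the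
  numerator to cancel it.\<close>

lemma Z_inv_integral:
  assumes "prime p" "x \<in> Z_inv p" "rat_pabs p x \<le> 1"
  shows "x \<in> \<int>"
proof (cases "x = 0")
  case False
  obtain a k where x: "x = of_int a / of_nat p ^ k" using assms(2) unfolding Z_inv_def by blast
  have p1: "real p > 1" using prime_gt_1_nat[OF assms(1)] by simp
  have a: "a \<noteq> 0" using False x by auto
  let ?m = "multiplicity (int p) a"
  have "inverse (real p ^ ?m) / inverse (real p ^ k) \<le> 1"
    using assms(3) unfolding x rat_pabs_divide[OF assms(1)] rat_pabs_power[OF assms(1)]
      rat_pabs_p[OF assms(1)] rat_pabs_of_int[OF assms(1) a]
    by (simp add: power_int_minus power_inverse)
  then have "real p ^ k \<le> real p ^ ?m" using p1 by (simp add: field_simps)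
  then have "k \<le> ?m" using p1 by simp
  then have "int p ^ k dvd a" by (rule multiplicity_dvd')
  then obtain b where "a = int p ^ k * b" by (rule dvdE)
  then have "x = of_int b" using x p1 by simp
  then show ?thesis by simp
qed simp

text \<open>Only the prime-to-\<open>p\<close> part \<open>b'\<close> of the denominator has to be
  removed, by inverting it modulo a power of \<open>p\<close>; the factor \<open>p ^ s\<close> may
  stay. The free choice of representative modulo that power controls the real size.\<close>

lemma Z_inv_approx:
  assumes "prime p"
  obtains a where "a \<in> Z_inv p" "rat_pabs p (x - a) \<le> inverse (real p ^ k)"
    "of_nat p ^ k \<le> a" "a < 2 * of_nat p ^ k"
proof -
  obtain m b where x: "x = of_int m / of_int b" "b \<noteq> 0" by (rule rat_frac)
  have p1: "p > 1" by (rule prime_gt_1_nat[OF assms])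
  have pe: "prime (int p)" using assms by simp
  obtain b' where b': "b = int p ^ multiplicity (int p) b * b'" "\<not> int p dvd b'"
    using multiplicity_decompose'[of b "int p"] x(2) pe by (metis not_prime_unit)
  define s where "s = multiplicity (int p) b"
  have "coprime b' (int p ^ (k + s))"
    using b'(2) pe by (metis coprime_commute coprime_power_right_iff prime_imp_coprime)
  then obtain d where d: "[b' * d = 1] (mod int p ^ (k + s))"
    using cong_solve_coprime_int by blast
  \<comment> \<open>The modulus carries \<open>s\<close> digits beyond the wanted precision, lost
    again on division by \<open>p ^ s\<close>. Adding one modulus to the residue puts
    \<open>c\<close> between one and two moduli, hence \<open>a\<close> between \<open>p ^ k\<close>
    and \<open>2 * p ^ k\<close>.\<close>
  define c where "c = (d * m) mod int p ^ (k + s) + int p ^ (k + s)"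
  define a :: rat where "a = of_int c / of_nat p ^ s"
  have N: "int p ^ (k + s) > 0" using p1 by simp
  have "0 \<le> (d * m) mod int p ^ (k + s)" "(d * m) mod int p ^ (k + s) < int p ^ (k + s)"
    using N by simp_all
  then have c: "int p ^ (k + s) \<le> c" "c < 2 * int p ^ (k + s)"
    unfolding c_def by linarith+
  have "[b' * c = b' * (d * m)] (mod int p ^ (k + s))"
    unfolding c_def by (intro cong_mult cong_refl) (simp add: cong_def)
  also have "[b' * (d * m) = 1 * m] (mod int p ^ (k + s))"
    using cong_mult[OF d cong_refl[of m]] by (simp add: mult.assoc)
  finally have "[m = b' * c] (mod int p ^ (k + s))" by (simp add: cong_sym)
  then have dvd: "int p ^ (k + s) dvd m - b' * c" by (simp add: cong_iff_dvd_diff)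
  have b'0: "b' \<noteq> 0" using b' by auto
  have b: "b = int p ^ s * b'" using b'(1) by (simp add: s_def)
  have "x - a = of_int (m - b' * c) / (of_nat p ^ s * of_int b')"
    unfolding x(1) a_def b using b'0 p1 by (simp add: field_simps)
  then have "rat_pabs p (x - a) = rat_pabs p (of_int (m - b' * c)) * real p ^ s"
    by (simp only: rat_pabs_divide rat_pabs_mult rat_pabs_power rat_pabs_p assms
        rat_pabs_of_int_eq_1[OF assms b'(2)]) (simp add: power_inverse divide_inverse)
  also have "\<dots> \<le> inverse (real p ^ (k + s)) * real p ^ s"
    by (intro mult_right_mono rat_pabs_of_int_le_power assms dvd) simp
  also have "\<dots> = inverse (real p ^ k)" using p1 by (simp add: power_add)
  finally have 1: "rat_pabs p (x - a) \<le> inverse (real p ^ k)" .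
  have ps: "(of_nat p ^ s :: rat) > 0" using p1 by simp
  have "of_int (int p ^ (k + s)) \<le> (of_int c :: rat)" using c(1) by (simp only: of_int_le_iff)
  then have 2: "of_nat p ^ k \<le> a"
    using ps unfolding a_def by (simp add: field_simps power_add)
  have "(of_int c :: rat) < of_int (2 * int p ^ (k + s))" using c(2) by (simp only: of_int_less_iff)
  then have 3: "a < 2 * of_nat p ^ k"
    using ps unfolding a_def by (simp add: field_simps power_add)
  have "a \<in> Z_inv p" unfolding a_def Z_inv_def by blast
  with 1 2 3 show ?thesis by (intro that)
qed

section \<open>Maximum norms\<close>

lemma pmax_ge: "rat_pabs p (q $ i) \<le> pmax p (q :: rat ^ 'n)"
  unfolding pmax_def by (rule Max_ge) auto

lemma pmax_attained: obtains i where "pmax p (q :: rat ^ 'n) = rat_pabs p (q $ i)"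
proof -
  have "pmax p q \<in> range (\<lambda>i. rat_pabs p (q $ i))"
    unfolding pmax_def by (rule Max_in) auto
  then show ?thesis using that by auto
qed

lemma pmax_nonneg: "pmax p (q :: rat ^ 'n) \<ge> 0"
  by (rule pmax_attained[of p q]) simp

lemma pmax_scale:
  assumes "prime p"
  shows "pmax p (r *s q) = rat_pabs p r * pmax p (q :: rat ^ 'n)"
proof (rule antisym)
  show "pmax p (r *s q) \<le> rat_pabs p r * pmax p q"
    by (rule pmax_attained[of p "r *s q"]) (simp add: rat_pabs_mult assms mult_left_mono pmax_ge)
  show "rat_pabs p r * pmax p q \<le> pmax p (r *s q)"
    using pmax_ge[of p "r *s q"]
    by (rule_tac pmax_attained[of p q]) (simp add: rat_pabs_mult assms)
qed

lemma supmax_ge: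
  "\<bar>real_of_rat q0\<bar> \<le> supmax q0 (q :: rat ^ 'n)"
  "\<bar>real_of_rat (q $ i)\<bar> \<le> supmax q0 (q :: rat ^ 'n)"
  unfolding supmax_def by (rule Max_ge; auto)+

lemma supmax_le_iff:
  "supmax q0 (q :: rat ^ 'n) \<le> M \<longleftrightarrow> \<bar>real_of_rat q0\<bar> \<le> M \<and> (\<forall>i. \<bar>real_of_rat (q $ i)\<bar> \<le> M)"
  unfolding supmax_def by (subst Max_le_iff) auto

lemma supmax_nonneg: "supmax q0 (q :: rat ^ 'n) \<ge> 0"
  using supmax_ge(1)[of q0 q] by linarith

lemma supmax_scale:
  "supmax (r * q0) (r *s q) = \<bar>real_of_rat r\<bar> * supmax q0 (q :: rat ^ 'n)"
proof (rule antisym)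
  show "supmax (r * q0) (r *s q) \<le> \<bar>real_of_rat r\<bar> * supmax q0 q"
    unfolding supmax_le_iff vector_smult_component of_rat_mult abs_mult
    by (intro conjI allI mult_left_mono supmax_ge abs_ge_zero)
  show "\<bar>real_of_rat r\<bar> * supmax q0 q \<le> supmax (r * q0) (r *s q)"
  proof (cases "r = 0")
    case True
    then show ?thesis by (simp add: supmax_nonneg)
  next
    case False
    have "supmax q0 q \<le> supmax (r * q0) (r *s q) / \<bar>real_of_rat r\<bar>"
      unfolding supmax_le_iff
      using supmax_ge(1)[of "r * q0" "r *s q"] supmax_ge(2)[of "r *s q" _ "r * q0"] False
      by (auto simp: pos_le_divide_eq of_rat_mult abs_mult mult.commute)
    then show ?thesis using False by (simp add: pos_le_divide_eq mult.commute)
  qed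
qed

section \<open>Integer vectors of bounded height\<close>

abbreviation of_int_vec :: "int ^ 'n \<Rightarrow> rat ^ 'n" where
  "of_int_vec q \<equiv> \<chi> i. of_int (q $ i)"

lemma finite_supmax_le:
  "finite {(q0 :: int, q :: int ^ 'n). supmax (of_int q0) (of_int_vec q) \<le> M}" (is "finite ?S")
proof -
  let ?I = "{- \<lfloor>M\<rfloor>..\<lfloor>M\<rfloor>}"
  have fin: "finite {q :: int ^ 'n. \<forall>i. q $ i \<in> ?I}"
  proof (rule finite_imageD)
    have "vec_nth ` {q :: int ^ 'n. \<forall>i. q $ i \<in> ?I} \<subseteq> Pi\<^sub>E UNIV (\<lambda>_. ?I)" by auto
    then show "finite (vec_nth ` {q :: int ^ 'n. \<forall>i. q $ i \<in> ?I})"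
      by (rule finite_subset) (auto intro!: finite_PiE)
  qed (simp add: inj_on_def vec_nth_inject)
  have le: "m \<in> ?I" if "\<bar>real_of_int m\<bar> \<le> M" for m
  proof -
    have "m \<le> \<lfloor>M\<rfloor>" "- m \<le> \<lfloor>M\<rfloor>" using that unfolding le_floor_iff by auto
    then show ?thesis by simp
  qed
  have "?S \<subseteq> ?I \<times> {q. \<forall>i. q $ i \<in> ?I}"
    by (auto simp only: supmax_le_iff vec_lambda_beta of_rat_of_int_eq mem_Collect_eq
        case_prod_conv mem_Times_iff intro!: le)
  then show ?thesis using fin by (rule_tac finite_subset) auto
qed

text \<open>Bounded sets of integer vectors are finite. This turns the infinitude in
  \<open>w_exp\<close> into a condition closer to that of \<open>wp_exp\<close>.\<close>

lemma infinite_iff_supmax_unbounded: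
  "infinite {(q0 :: int, q :: int ^ 'n). P q0 q} \<longleftrightarrow>
    (\<forall>M. \<exists>q0 q. P q0 q \<and> supmax (of_int q0) (of_int_vec q) > M)"
proof
  assume inf: "infinite {(q0 :: int, q :: int ^ 'n). P q0 q}"
  show "\<forall>M. \<exists>q0 q. P q0 q \<and> supmax (of_int q0) (of_int_vec q) > M"
  proof (rule allI, rule ccontr)
    fix M
    assume "\<nexists>q0 q. P q0 q \<and> supmax (of_int q0) (of_int_vec q) > M"
    then have "{(q0, q). P q0 q} \<subseteq> {(q0, q). supmax (of_int q0) (of_int_vec q) \<le> M}"
      by (auto simp: not_less)
    with inf finite_supmax_le show False by (metis finite_subset)
  qed
next
  let ?S = "{(q0 :: int, q :: int ^ 'n). P q0 q}"
  let ?h = "\<lambda>(q0, q). supmax (of_int q0) (of_int_vec q)"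
  assume unb: "\<forall>M. \<exists>q0 q. P q0 q \<and> supmax (of_int q0) (of_int_vec q) > M"
  show "infinite ?S"
  proof
    assume fin: "finite ?S"
    obtain q0 q where q: "P q0 q" "supmax (of_int q0) (of_int_vec q) > Max (?h ` ?S)"
      using unb by blast
    then have "?h (q0, q) \<le> Max (?h ` ?S)" using fin by (intro Max_ge) auto
    with q(2) show False by simp
  qed
qed

text \<open>One nonzero coordinate suffices: the product of its two absolute values is already at
  least 1.\<close>

lemma pmax_supmax_ge_1:
  assumes "prime p" "q \<noteq> 0"
  shows "1 \<le> pmax p (of_int_vec (q :: int ^ 'n)) * supmax (of_int q0) (of_int_vec q)"
proof -
  obtain i where "q $ i \<noteq> 0" using assms(2) by (auto simp: vec_eq_iff)
  then have "1 \<le> rat_pabs p (of_int (q $ i)) * \<bar>of_int (q $ i)\<bar>"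
    by (rule rat_pabs_of_int_times_abs_ge_1[OF assms(1)])
  also have "\<dots> \<le> pmax p (of_int_vec q) * supmax (of_int q0) (of_int_vec q)"
    using pmax_ge[of p "of_int_vec q" i] supmax_ge(2)[of "of_int_vec q" i "of_int q0"]
    by (intro mult_mono) (auto intro: order_trans[OF rat_pabs_nonneg])
  finally show ?thesis .
qed

lemma pmax_of_int_vec_le_1:
  assumes "prime p"
  shows "pmax p (of_int_vec (q :: int ^ 'n)) \<le> 1"
  by (rule pmax_attained[of p "of_int_vec q"]) (simp add: rat_pabs_of_int_le_1 assms)

section \<open>Values of linear forms\<close>

lemma pCauchy_sum:
  assumes "prime p" "finite A" "\<And>i. i \<in> A \<Longrightarrow> pCauchy p (f i)"
  shows "pCauchy p (\<lambda>k. \<Sum>i\<in>A. f i k)"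
  using assms(2,3) by (induction A) (simp_all add: pCauchy_add assms(1))

lemma pCauchy_ring_finsum:
  assumes "prime p" "finite A" "\<And>i. i \<in> A \<Longrightarrow> pCauchy p (f i)"
  shows "(\<Oplus>\<^bsub>pCauchy_ring p\<^esub> i\<in>A. f i) = (\<lambda>k. \<Sum>i\<in>A. f i k)"
proof -
  interpret R: cring "pCauchy_ring p" by (rule pCauchy_cring[OF assms(1)])
  show ?thesis using assms(2,3)
  proof (induction A)
    case empty
    then show ?case by simp
  next
    case (insert a A)
    then have "(\<Oplus>\<^bsub>pCauchy_ring p\<^esub> i\<in>insert a A. f i)
        = f a \<oplus>\<^bsub>pCauchy_ring p\<^esub> (\<Oplus>\<^bsub>pCauchy_ring p\<^esub> i\<in>A. f i)"
      by (intro R.finsum_insert) auto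
    then show ?case using insert by simp
  qed
qed

locale padic_point =
  fixes p :: nat and y :: "padic ^ 'n"
  assumes prime_p: "prime p"
    and y_carrier: "y $ i \<in> carrier (Qp p)"
begin

abbreviation form_abs :: "rat \<Rightarrow> rat ^ 'n \<Rightarrow> real" where
  "form_abs q0 q \<equiv> Qp_abs p (Qp_form p q0 q y)"

lemma p_gt_1: "real p > 1"
  using prime_gt_1_nat[OF prime_p] by simp

text \<open>Representatives of the coordinates of \<open>y\<close> reduce every statement on the linear form
  to one on limits of rational absolute values.\<close>

lemma form_abs_limit:
  "\<exists>x. (\<forall>i. pCauchy p (x i)) \<and>
    (\<forall>q0 q. (\<lambda>k. rat_pabs p (q0 + (\<Sum>i\<in>UNIV. q $ i * x i k))) \<longlonglongrightarrow> form_abs q0 q)"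
proof -
  let ?R = "pCauchy_ring p"
  let ?h = "\<lambda>x. pnull p +>\<^bsub>?R\<^esub> x"
  interpret I: ideal "pnull p" ?R by (rule pnull_ideal[OF prime_p])
  interpret R: cring ?R by (rule pCauchy_cring[OF prime_p])
  interpret Q: field "Qp p" by (rule Qp_field[OF prime_p])
  have hom: "?h \<in> ring_hom ?R (Qp p)" unfolding Qp_def by (rule I.rcos_ring_hom)
  interpret H: ring_hom_cring ?R "Qp p" ?h
    using hom by unfold_locales
  have "\<exists>x. pCauchy p x \<and> y $ i = ?h x" for i
    using y_carrier[of i] by (auto simp: Qp_def FactRing_def A_RCOSETS_def')
  then obtain x where x: "\<And>i. pCauchy p (x i)" "\<And>i. y $ i = ?h (x i)" by metis
  \<comment> \<open>The coset map is a ring homomorphism, so the form at \<open>y\<close> is the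
    coset of the termwise rational forms in the representatives.\<close>
  have "Qp_form p q0 q y = ?h (\<lambda>k. q0 + (\<Sum>i\<in>UNIV. q $ i * x i k))" for q0 and q :: "rat ^ 'n"
  proof -
    have C: "pCauchy p (\<lambda>k. q $ i * x i k)" for i
      by (rule pCauchy_mult[OF prime_p pCauchy_const x(1)])
    have "Qp_of_rat p (q $ i) \<otimes>\<^bsub>Qp p\<^esub> (y $ i) = ?h (\<lambda>k. q $ i * x i k)" for i
      using H.hom_mult[of "\<lambda>_. q $ i" "x i"] x by (simp add: Qp_of_rat_def)
    then have "(\<Oplus>\<^bsub>Qp p\<^esub> i\<in>UNIV. Qp_of_rat p (q $ i) \<otimes>\<^bsub>Qp p\<^esub> (y $ i))
        = (\<Oplus>\<^bsub>Qp p\<^esub> i\<in>UNIV. ?h (\<lambda>k. q $ i * x i k))" by simp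
    also have "\<dots> = ?h (\<Oplus>\<^bsub>?R\<^esub> i\<in>UNIV. (\<lambda>k. q $ i * x i k))"
      using C by (subst H.hom_finsum) (auto simp: o_def)
    also have "\<dots> = ?h (\<lambda>k. \<Sum>i\<in>UNIV. q $ i * x i k)"
      using C by (simp add: pCauchy_ring_finsum prime_p)
    finally have "Qp_form p q0 q y = ?h (\<lambda>_. q0) \<oplus>\<^bsub>Qp p\<^esub> ?h (\<lambda>k. \<Sum>i\<in>UNIV. q $ i * x i k)"
      by (simp add: Qp_form_def Qp_of_rat_def)
    also have "\<dots> = ?h ((\<lambda>_. q0) \<oplus>\<^bsub>?R\<^esub> (\<lambda>k. \<Sum>i\<in>UNIV. q $ i * x i k))"
      using C by (intro H.hom_add[symmetric]) (simp_all add: pCauchy_sum prime_p)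
    finally show ?thesis by simp
  qed
  then have "(\<lambda>k. rat_pabs p (q0 + (\<Sum>i\<in>UNIV. q $ i * x i k))) \<longlonglongrightarrow> form_abs q0 q"
    for q0 and q :: "rat ^ 'n"
    using x(1) by (simp only:)
      (intro Qp_abs_coset pCauchy_add pCauchy_sum pCauchy_mult pCauchy_const prime_p finite)
  with x(1) show ?thesis by blast
qed

lemma form_abs_nonneg: "form_abs q0 q \<ge> 0"
proof -
  obtain x where
    "\<And>q0 q. (\<lambda>k. rat_pabs p (q0 + (\<Sum>i\<in>UNIV. q $ i * x i k))) \<longlonglongrightarrow> form_abs q0 q"
    using form_abs_limit by blast
  then show ?thesis by (rule LIMSEQ_le_const) simp
qed

lemma form_abs_scale: "form_abs (r * q0) (r *s q) = rat_pabs p r * form_abs q0 q"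
proof -
  obtain x where x:
    "\<And>q0 q. (\<lambda>k. rat_pabs p (q0 + (\<Sum>i\<in>UNIV. q $ i * x i k))) \<longlonglongrightarrow> form_abs q0 q"
    using form_abs_limit by blast
  have "(\<lambda>k. rat_pabs p (r * q0 + (\<Sum>i\<in>UNIV. (r *s q) $ i * x i k)))
      = (\<lambda>k. rat_pabs p r * rat_pabs p (q0 + (\<Sum>i\<in>UNIV. q $ i * x i k)))"
    by (simp add: rat_pabs_mult[OF prime_p, symmetric] distrib_left sum_distrib_left mult.assoc)
  then show ?thesis
    using x[of "r * q0" "r *s q"] tendsto_mult_left[OF x[of q0 q], of "rat_pabs p r"]
    by (auto intro: LIMSEQ_unique)
qed

lemma form_abs_0_right: "form_abs q0 0 = rat_pabs p q0"
proof -
  obtain x where x: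
    "\<And>q0 q. (\<lambda>k. rat_pabs p (q0 + (\<Sum>i\<in>UNIV. q $ i * x i k))) \<longlonglongrightarrow> form_abs q0 q"
    using form_abs_limit by blast
  from x[of q0 0] show ?thesis by (simp add: LIMSEQ_const_iff)
qed

text \<open>The constant term is the value of the form minus the linear part, and the ultrametric
  inequality bounds the latter by \<open>pmax\<close> times a bound for the coordinates of
  \<open>y\<close>.\<close>

lemma rat_pabs_const_term_le:
  "\<exists>c. \<forall>q0 q. rat_pabs p q0 \<le> max (form_abs q0 q) (real p ^ c * pmax p q)"
proof -
  obtain x where x: "\<And>i. pCauchy p (x i)"
    "\<And>q0 q. (\<lambda>k. rat_pabs p (q0 + (\<Sum>i\<in>UNIV. q $ i * x i k))) \<longlonglongrightarrow> form_abs q0 q"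
    using form_abs_limit by blast
  have "\<exists>C. \<forall>k. rat_pabs p (x i k) \<le> C" for i
    by (rule pCauchy_bounded[OF prime_p x(1)]) blast
  then obtain C where C: "\<And>i k. rat_pabs p (x i k) \<le> C i" by metis
  \<comment> \<open>The bound is taken to be a power of \<open>p\<close> because it later serves as
    a scaling factor within Z[1/p].\<close>
  obtain c where c: "real p ^ c > Max (range C)"
    using real_arch_pow[OF p_gt_1] by blast
  have xc: "rat_pabs p (x i k) \<le> real p ^ c" for i k
  proof -
    have "C i \<le> Max (range C)" by (rule Max_ge) auto
    then show ?thesis using C[of i k] c by linarith
  qed
  show ?thesis
  proof (intro exI allI)
    fix q0 and q :: "rat ^ 'n"
    have "rat_pabs p q0 \<le> max (rat_pabs p (q0 + (\<Sum>i\<in>UNIV. q $ i * x i k))) (real p ^ c * pmax p q)"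
      for k
    proof -
      let ?s = "\<Sum>i\<in>UNIV. q $ i * x i k"
      have "rat_pabs p ?s \<le> real p ^ c * pmax p q"
      proof (rule rat_pabs_sum_le[OF prime_p])
        fix i
        show "rat_pabs p (q $ i * x i k) \<le> real p ^ c * pmax p q"
          using mult_mono[OF xc pmax_ge] p_gt_1
          by (simp add: rat_pabs_mult prime_p mult.commute pmax_nonneg)
      qed (use p_gt_1 pmax_nonneg[of p q] in simp)
      then show ?thesis
        using rat_pabs_add_le_max[OF prime_p, of "q0 + ?s" "- ?s"] by auto
    qed
    then show "rat_pabs p q0 \<le> max (form_abs q0 q) (real p ^ c * pmax p q)"
      by (intro tendsto_lowerbound[OF tendsto_max[OF x(2) tendsto_const]]) auto
  qed
qed

text \<open>Approximating a sufficiently late term of a Cauchy representative also approximates the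
  coordinate itself.\<close>

lemma axis_form_approx:
  obtains a where "a \<in> Z_inv p" "of_nat p ^ k \<le> a" "a < 2 * of_nat p ^ k"
    "form_abs (- a) (axis i 1) \<le> inverse (real p ^ k)"
proof -
  obtain x where x: "\<And>i. pCauchy p (x i)"
    "\<And>q0 q. (\<lambda>k. rat_pabs p (q0 + (\<Sum>i\<in>UNIV. q $ i * x i k))) \<longlonglongrightarrow> form_abs q0 q"
    using form_abs_limit by blast
  have pk: "inverse (real p ^ k) > 0" using p_gt_1 by simp
  then obtain N where N: "\<And>m. m \<ge> N \<Longrightarrow> rat_pabs p (x i m - x i N) < inverse (real p ^ k)"
    using x(1)[of i] unfolding pCauchy_def by blast
  obtain a where a: "a \<in> Z_inv p" "rat_pabs p (x i N - a) \<le> inverse (real p ^ k)"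
    "of_nat p ^ k \<le> a" "a < 2 * of_nat p ^ k"
    by (rule Z_inv_approx[OF prime_p])
  have "rat_pabs p (- a + (\<Sum>j\<in>UNIV. axis i 1 $ j * x j m)) \<le> inverse (real p ^ k)" if "m \<ge> N" for m
  proof -
    have "(\<Sum>j\<in>UNIV. axis i 1 $ j * x j m) = (\<Sum>j\<in>UNIV. if j = i then x j m else 0)"
      by (intro sum.cong) (auto simp: axis_def)
    then have "- a + (\<Sum>j\<in>UNIV. axis i 1 $ j * x j m) = (x i m - x i N) + (x i N - a)" by simp
    then show ?thesis
      using rat_pabs_add_le_max[OF prime_p, of "x i m - x i N" "x i N - a"] N[OF that] a(2)
      by auto
  qed
  then have "form_abs (- a) (axis i 1) \<le> inverse (real p ^ k)"
    by (intro LIMSEQ_le_const2[OF x(2)[of "- a" "axis i 1"]]) blast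
  with a show ?thesis by (intro that)
qed

text \<open>Multiplying a vector by \<open>p ^ c * pmax p q\<close>, a power of \<open>p\<close>, makes it integral; the fixed
  factor \<open>p ^ c\<close> absorbs the denominators of \<open>y\<close>.\<close>

lemma integral_rescaling:
  "\<exists>K\<ge>1. \<forall>q0 q.
    q0 \<in> Z_inv p \<and> (\<forall>i. q $ i \<in> Z_inv p) \<and> pmax p q > 0 \<and> form_abs q0 q \<le> pmax p q \<longrightarrow>
      (\<exists>m0 m. supmax (of_int m0) (of_int_vec m) = K * (pmax p q * supmax q0 q) \<and>
        form_abs (of_int m0) (of_int_vec m) = form_abs q0 q / (K * pmax p q))"
proof -
  obtain c where c:
    "\<And>q0 q. rat_pabs p q0 \<le> max (form_abs q0 q) (real p ^ c * pmax p q)"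
    using rat_pabs_const_term_le by blast
  have K1: "real p ^ c \<ge> 1" using p_gt_1 by (intro one_le_power) simp
  show ?thesis
  proof (intro exI[of _ "real p ^ c"] conjI K1 allI impI, elim conjE)
    fix q0 and q :: "rat ^ 'n"
    assume q0: "q0 \<in> Z_inv p" and q: "\<forall>i. q $ i \<in> Z_inv p"
      and pos: "pmax p q > 0" and le: "form_abs q0 q \<le> pmax p q"
    obtain i where i: "pmax p q = rat_pabs p (q $ i)" by (rule pmax_attained)
    then obtain t where t: "pmax p q = real p powi t"
      using rat_pabs_range[of p "q $ i"] pos by force
    \<comment> \<open>The real size of \<open>r\<close> is \<open>p ^ c * pmax p q\<close> and its
      p-adic absolute value is the inverse of that, so scaling trades p-adic size for
      height.\<close>
    define r :: rat where "r = of_nat p powi (int c + t)"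
    have p0: "p \<noteq> 0" using p_gt_1 by auto
    have rK: "real_of_rat r = real p ^ c * pmax p q"
      using p0 by (simp add: r_def t power_int_add of_rat_mult of_rat_p_powi of_rat_power)
    have rp: "rat_pabs p r = inverse (real p ^ c * pmax p q)"
      unfolding r_def rat_pabs_p_powi[OF prime_p] t using p0
      by (simp add: power_int_add power_int_minus power_int_diff field_simps)
    have rZ: "r \<in> Z_inv p" unfolding r_def by (rule Z_inv_p_powi)
    have pm: "pmax p (r *s q) \<le> 1"
    proof -
      have "pmax p (r *s q) = inverse (real p ^ c)"
        unfolding pmax_scale[OF prime_p] rp using pos by (simp add: field_simps)
      then show ?thesis using le_imp_inverse_le[OF K1] by simp
    qed
    have "(r *s q) $ j \<in> \<int>" for j
    proof (rule Z_inv_integral[OF prime_p])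
      show "(r *s q) $ j \<in> Z_inv p" using q rZ by (simp add: Z_inv_mult)
      show "rat_pabs p ((r *s q) $ j) \<le> 1" using pm pmax_ge[of p "r *s q" j] by linarith
    qed
    then have m: "of_int_vec (\<chi> j. \<lfloor>(r *s q) $ j\<rfloor>) = r *s q"
      unfolding vec_eq_iff vec_lambda_beta by (intro allI of_int_floor)
    \<comment> \<open>As the form is at most \<open>pmax p q\<close>, both terms in the maximum
      bounding \<open>q0\<close> are at most \<open>p ^ c * pmax p q\<close>; hence \<open>r\<close>
      makes the constant term integral too.\<close>
    have "pmax p q \<le> real p ^ c * pmax p q"
      using mult_right_mono[OF K1 pmax_nonneg] by (simp only: mult_1)
    then have "rat_pabs p q0 \<le> real p ^ c * pmax p q"
      using c[of q0 q] le by linarith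
    then have "rat_pabs p (r * q0) \<le> 1"
      unfolding rat_pabs_mult[OF prime_p] rp divide_inverse[symmetric] mult.commute[of "inverse _"]
      using pos p_gt_1 by (subst pos_divide_le_eq) auto
    then have "r * q0 \<in> \<int>" using Z_inv_integral[OF prime_p Z_inv_mult[OF rZ q0]] by blast
    then obtain m0 where m0: "of_int m0 = r * q0" by (metis Ints_cases)
    show "\<exists>m0 m. supmax (of_int m0) (of_int_vec m) = real p ^ c * (pmax p q * supmax q0 q) \<and>
        form_abs (of_int m0) (of_int_vec m) = form_abs q0 q / (real p ^ c * pmax p q)"
      by (intro exI[of _ m0] exI[of _ "\<chi> j. \<lfloor>(r *s q) $ j\<rfloor>"])
        (simp only: m m0 supmax_scale form_abs_scale rK rp abs_mult,
          use pos in \<open>simp add: field_simps\<close>)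
  qed
qed

subsection \<open>Comparison of the exponents\<close>

lemma w_exp_ge:
  assumes "v > 0"
    "\<And>M. \<exists>q0 q. form_abs (of_int q0) (of_int_vec q) \<le> supmax (of_int q0) (of_int_vec q) powr (- v)
      \<and> supmax (of_int q0) (of_int_vec q) > M"
  shows "ereal v \<le> w_exp p y"
  unfolding w_exp_def using assms
  by (intro Sup_upper) (simp add: infinite_iff_supmax_unbounded)

lemma wp_exp_ge:
  assumes "\<And>B. B \<ge> 1 \<Longrightarrow> \<exists>q0\<in>Z_inv p. \<exists>q. (\<forall>i. q $ i \<in> Z_inv p) \<and> pmax p q * supmax q0 q > B \<and>
    form_abs q0 q < 1 / ((pmax p q * supmax q0 q) powr v * supmax q0 q)"
  shows "ereal v \<le> wp_exp p y"
  unfolding wp_exp_def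
proof (intro Sup_upper CollectI exI conjI allI)
  fix B
  show "\<exists>q0\<in>Z_inv p. \<exists>q. (\<forall>i. q $ i \<in> Z_inv p) \<and> pmax p q * supmax q0 q > B \<and>
      form_abs q0 q < 1 / ((pmax p q * supmax q0 q) powr v * supmax q0 q)"
    \<comment> \<open>Solutions beyond \<open>max B 1\<close> also lie beyond \<open>B\<close>; the
      restriction \<open>B \<ge> 1\<close> later supplies positivity for powers and
      quotients.\<close>
    using assms[of "max B 1"] by auto
qed (rule refl)

section \<open>Lower bounds valid at every point\<close>

lemma one_le_w_exp: "1 \<le> w_exp p y"
proof -
  have "ereal 1 \<le> w_exp p y"
  proof (rule w_exp_ge)
    fix M
    obtain k where k: "real p ^ k > M" using real_arch_pow[OF p_gt_1] by blast
    have p0: "real p ^ k > 0" using p_gt_1 by simp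
    have z: "of_int_vec (0 :: int ^ 'n) = 0" by (simp add: vec_eq_iff)
    have "supmax (of_int (int p ^ k)) (0 :: rat ^ 'n) = real p ^ k"
    proof (rule antisym)
      show "supmax (of_int (int p ^ k)) (0 :: rat ^ 'n) \<le> real p ^ k"
        unfolding supmax_le_iff by (simp add: of_rat_power)
      show "real p ^ k \<le> supmax (of_int (int p ^ k)) (0 :: rat ^ 'n)"
        using supmax_ge(1)[of "of_int (int p ^ k)" "0 :: rat ^ 'n"] by (simp add: of_rat_power)
    qed
    \<comment> \<open>The value is exactly the inverse of the height, so exponent 1 is
      attained.\<close>
    moreover have "form_abs (of_int (int p ^ k)) 0 = inverse (real p ^ k)"
      by (simp add: form_abs_0_right rat_pabs_power rat_pabs_p prime_p power_inverse)
    ultimately show "\<exists>q0 q. form_abs (of_int q0) (of_int_vec q)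
          \<le> supmax (of_int q0) (of_int_vec q) powr (- 1)
        \<and> supmax (of_int q0) (of_int_vec q) > M"
      using k p0
      by (intro exI[of _ "int p ^ k"] exI[of _ "0 :: int ^ 'n"])
        (simp only: z, simp add: powr_minus)
  qed simp
  then show ?thesis by (simp add: one_ereal_def)
qed

lemma wp_exp_nonneg: "0 \<le> wp_exp p y"
proof (rule ereal_le_epsilon2)
  fix e :: real
  assume e: "0 < e"
  have "ereal (- e) \<le> wp_exp p y"
  proof (rule wp_exp_ge)
    fix B :: real
    assume B: "B \<ge> 1"
    \<comment> \<open>The height \<open>H\<close> of the approximation may be almost
      \<open>2 * p ^ k\<close>. The threshold \<open>2 powr (1 / e)\<close> makes
      \<open>H powr e\<close> exceed 2, which absorbs this factor.\<close>
    obtain k where k: "real p ^ k > max B (2 powr (1 / e))"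
      using real_arch_pow[OF p_gt_1] by blast
    define i :: 'n where "i = undefined"
    obtain a where a: "a \<in> Z_inv p" "of_nat p ^ k \<le> a" "a < 2 * of_nat p ^ k"
      "form_abs (- a) (axis i 1) \<le> inverse (real p ^ k)"
      by (rule axis_form_approx)
    define H where "H = real_of_rat a"
    have "real_of_rat (of_nat p ^ k) \<le> H" unfolding H_def using a(2) by (simp only: of_rat_less_eq)
    then have H1: "real p ^ k \<le> H" by (simp add: of_rat_power)
    have "H < real_of_rat (2 * of_nat p ^ k)" unfolding H_def using a(3) by (simp only: of_rat_less)
    then have H2: "H < 2 * real p ^ k" by (simp add: of_rat_power of_rat_mult)
    have HB: "H > B" and H_gt: "H > 1" using k H1 B by auto
    have sm: "supmax (- a) (axis i 1 :: rat ^ 'n) = H"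
    proof (rule antisym)
      have "\<bar>real_of_rat (- a)\<bar> = H" using H_gt by (simp add: H_def of_rat_minus)
      moreover have "\<bar>real_of_rat ((axis i 1 :: rat ^ 'n) $ j)\<bar> \<le> H" for j
        using H_gt by (simp add: axis_def)
      ultimately show "supmax (- a) (axis i 1 :: rat ^ 'n) \<le> H" by (simp add: supmax_le_iff)
      show "H \<le> supmax (- a) (axis i 1 :: rat ^ 'n)"
        using supmax_ge(1)[of "- a" "axis i 1 :: rat ^ 'n"] unfolding H_def of_rat_minus by linarith
    qed
    have pm: "pmax p (axis i 1 :: rat ^ 'n) = 1"
    proof (rule antisym)
      show "pmax p (axis i 1 :: rat ^ 'n) \<le> 1"
        by (rule pmax_attained[of p "axis i 1"]) (simp add: axis_def prime_p)
      show "1 \<le> pmax p (axis i 1 :: rat ^ 'n)"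
        using pmax_ge[of p "axis i 1" i] by (simp add: axis_def prime_p)
    qed
    have "2 = (2 powr (1 / e)) powr e" using e by (simp add: powr_powr)
    also have "\<dots> < H powr e" using e k H1 by (intro powr_less_mono2) auto
    finally have He: "2 < H powr e" .
    have pk: "real p ^ k > 0" using p_gt_1 by simp
    have "H / real p ^ k < 2" using H2 pk by (simp add: field_simps)
    then have "inverse (real p ^ k) * H < H powr e" using He by (simp add: field_simps)
    then have "inverse (real p ^ k) < 1 / (H powr (- e) * H)"
      using H_gt by (simp add: powr_minus field_simps)
    then have "form_abs (- a) (axis i 1) < 1 / (H powr (- e) * H)" using a(4) by linarith
    moreover have "- a \<in> Z_inv p" using Z_inv_mult[OF Z_inv_of_int[of "- 1"] a(1)] by simp
    moreover have "(axis i 1 :: rat ^ 'n) $ j \<in> Z_inv p" for j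
      using Z_inv_of_int[of 0 p] Z_inv_of_int[of 1 p] by (auto simp: axis_def)
    ultimately show "\<exists>q0\<in>Z_inv p. \<exists>q. (\<forall>i. q $ i \<in> Z_inv p) \<and> pmax p q * supmax q0 q > B \<and>
        form_abs q0 q < 1 / ((pmax p q * supmax q0 q) powr (- e) * supmax q0 q)"
      using HB by (intro bexI[of _ "- a"] exI[of _ "axis i 1"]) (simp_all add: sm pm)
  qed
  then have "ereal (- e) + ereal e \<le> wp_exp p y + ereal e" by (rule add_right_mono)
  then show "0 \<le> wp_exp p y + ereal e" by (simp add: zero_ereal_def)
qed

section \<open>The inequality w \<le> w_p + 1\<close>

text \<open>A vanishing form satisfies the strict inequality for every exponent once the right-hand
  side is positive. Scaling by integers congruent to 1 modulo \<open>p\<close> keeps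
  \<open>pmax\<close> and raises \<open>supmax\<close>, so their product is unbounded.\<close>

lemma wp_exp_eq_infinity:
  assumes "q \<noteq> 0" "form_abs (of_int q0) (of_int_vec q) = 0"
  shows "wp_exp p y = \<infinity>"
proof (rule ereal_top)
  fix u
  show "ereal u \<le> wp_exp p y"
  proof (rule wp_exp_ge)
    fix B :: real
    assume B: "B \<ge> 1"
    let ?H = "pmax p (of_int_vec q) * supmax (of_int q0) (of_int_vec q)"
    have H: "?H \<ge> 1" by (rule pmax_supmax_ge_1[OF prime_p assms(1)])
    obtain k :: nat where k: "real k > B" using reals_Archimedean2 by blast
    define r where "r = int (p * k + 1)"
    have "\<not> int p dvd r"
    proof
      assume "int p dvd r"
      then have "p dvd p * k + 1" unfolding r_def int_dvd_int_iff .
      then have "p dvd 1" by (metis dvd_add_right_iff dvd_triv_left)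
      with prime_p show False by auto
    qed
    then have rp: "rat_pabs p (of_int r) = 1" by (rule rat_pabs_of_int_eq_1[OF prime_p])
    have "real k \<le> real p * real k" using p_gt_1 mult_right_mono[of 1 "real p" "real k"] by simp
    then have rB: "real_of_int r > B" using k by (simp add: r_def)
    let ?q = "of_int r *s of_int_vec q"
    have pm: "pmax p ?q = pmax p (of_int_vec q)" by (simp add: pmax_scale[OF prime_p] rp)
    have sm: "supmax (of_int r * of_int q0) ?q = real_of_int r * supmax (of_int q0) (of_int_vec q)"
      using rB B by (simp only: supmax_scale) simp
    have "B < real_of_int r * 1" using rB by simp
    also have "\<dots> \<le> real_of_int r * ?H" using H rB B by (intro mult_left_mono) auto
    finally have gt: "pmax p ?q * supmax (of_int r * of_int q0) ?q > B"
      unfolding pm sm by (simp add: mult.left_commute)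
    then have "supmax (of_int r * of_int q0) ?q \<noteq> 0" using B by auto
    then have "supmax (of_int r * of_int q0) ?q > 0" using supmax_nonneg[of "of_int r * of_int q0" ?q] by simp
    moreover have "(pmax p ?q * supmax (of_int r * of_int q0) ?q) powr u > 0"
      unfolding powr_gt_zero using gt B by linarith
    ultimately have "0 < 1 / ((pmax p ?q * supmax (of_int r * of_int q0) ?q) powr u
        * supmax (of_int r * of_int q0) ?q)"
      by (intro divide_pos_pos mult_pos_pos zero_less_one)
    moreover have "form_abs (of_int r * of_int q0) ?q = 0" by (simp only: form_abs_scale assms(2) mult_zero_right)
    moreover have "of_int r * of_int q0 \<in> Z_inv p" by (metis Z_inv_of_int of_int_mult)
    moreover have "?q $ i \<in> Z_inv p" for i by (simp flip: of_int_mult)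
    ultimately show "\<exists>q0\<in>Z_inv p. \<exists>q. (\<forall>i. q $ i \<in> Z_inv p) \<and> pmax p q * supmax q0 q > B \<and>
        form_abs q0 q < 1 / ((pmax p q * supmax q0 q) powr u * supmax q0 q)"
      using gt by (intro bexI[of _ "of_int r * of_int q0"] exI[of _ ?q]) simp_all
  qed
qed

text \<open>If \<open>pmax * supmax\<close> stayed bounded along the solutions, then after rescaling only finitely many
  integer vectors would occur, while the values of the form at them would tend to \<open>0\<close>.\<close>

lemma solution_unbounded:
  assumes v: "v > 1"
    and nonvanishing: "\<And>q0 q. q \<noteq> 0 \<Longrightarrow> form_abs (of_int q0) (of_int_vec q) \<noteq> 0"
    and solutions: "\<And>M. \<exists>q0 q. form_abs (of_int q0) (of_int_vec q)
        \<le> supmax (of_int q0) (of_int_vec q) powr (- v)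
      \<and> supmax (of_int q0) (of_int_vec q) > M"
  shows "\<exists>q0 q. form_abs (of_int q0) (of_int_vec q) \<le> supmax (of_int q0) (of_int_vec q) powr (- v)
    \<and> pmax p (of_int_vec q) * supmax (of_int q0) (of_int_vec q) > B"
proof -
  obtain K where K: "K \<ge> 1" and resc: "\<And>q0 q. q0 \<in> Z_inv p \<Longrightarrow> \<forall>i. q $ i \<in> Z_inv p \<Longrightarrow> pmax p q > 0 \<Longrightarrow>
      form_abs q0 q \<le> pmax p q \<Longrightarrow>
      \<exists>m0 m. supmax (of_int m0) (of_int_vec m) = K * (pmax p q * supmax q0 q) \<and>
        form_abs (of_int m0) (of_int_vec m) = form_abs q0 q / (K * pmax p q)"
    using integral_rescaling by blast
  \<comment> \<open>The set \<open>V\<close> holds the positive values at integer vectors of height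
    at most \<open>K * B\<close>. It is finite, so \<open>d\<close> is a positive lower bound for
    it; the inserted 1 covers an empty \<open>V\<close>.\<close>
  define V where "V = (\<lambda>(q0, q). form_abs (of_int q0) (of_int_vec q)) `
    {(q0, q). supmax (of_int q0) (of_int_vec q) \<le> K * B} \<inter> {0<..}"
  have finV: "finite V" unfolding V_def using finite_supmax_le by blast
  define d where "d = Min (insert 1 V)"
  have d: "d > 0" unfolding d_def using finV by (subst Min_gr_iff) (auto simp: V_def)
  \<comment> \<open>Since \<open>1 - v\<close> is negative, a height beyond
    \<open>d powr (1 / (1 - v))\<close> gives \<open>sm powr (1 - v) < d\<close>.\<close>
  obtain q0 q where sol: "form_abs (of_int q0) (of_int_vec q)
      \<le> supmax (of_int q0) (of_int_vec q) powr (- v)"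
    and large: "supmax (of_int q0) (of_int_vec q) > max 1 (d powr (1 / (1 - v)))"
    using solutions by blast
  define L where "L = form_abs (of_int q0) (of_int_vec q)"
  define pm where "pm = pmax p (of_int_vec q)"
  define sm where "sm = supmax (of_int q0) (of_int_vec q)"
  have sm1: "sm > 1" and smd: "sm > d powr (1 / (1 - v))" using large by (auto simp: sm_def)
  have Lv: "L \<le> sm powr (- v)" using sol by (simp add: L_def sm_def)
  have split: "sm powr (1 - v) = sm powr (- v) * sm"
    using sm1 powr_add[of sm "- v" 1] by simp
  \<comment> \<open>For \<open>q = 0\<close> the form is the integer \<open>q0\<close>, whose two
    absolute values have product at least 1, against
    \<open>L * sm \<le> sm powr (1 - v) < 1\<close>.\<close>
  have q: "q \<noteq> 0"
  proof
    assume q0': "q = 0"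
    then have z: "of_int_vec q = 0" by (simp add: vec_eq_iff)
    have smq: "sm = \<bar>of_int q0\<bar>"
    proof (rule antisym)
      show "sm \<le> \<bar>of_int q0\<bar>" unfolding sm_def supmax_le_iff by (simp add: q0')
      show "\<bar>of_int q0\<bar> \<le> sm"
        using supmax_ge(1)[of "of_int q0" "of_int_vec q"] by (simp add: sm_def)
    qed
    then have "q0 \<noteq> 0" using sm1 by auto
    then have "1 \<le> rat_pabs p (of_int q0) * sm"
      unfolding smq by (rule rat_pabs_of_int_times_abs_ge_1[OF prime_p])
    also have "rat_pabs p (of_int q0) = L" by (simp only: L_def z form_abs_0_right)
    also have "L * sm \<le> sm powr (1 - v)" unfolding split using Lv sm1 by simp
    also have "\<dots> < sm powr 0" using v sm1 by (intro powr_less_mono) auto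
    finally show False using sm1 by simp
  qed
  have H: "pm * sm \<ge> 1" unfolding pm_def sm_def by (rule pmax_supmax_ge_1[OF prime_p q])
  have pm0: "pm > 0"
  proof -
    have "pm \<noteq> 0" using H by auto
    then show ?thesis using pmax_nonneg[of p "of_int_vec q"] by (simp add: pm_def)
  qed
  \<comment> \<open>By \<open>H\<close>, dividing by \<open>pm\<close> costs at most one power of
    the height, which \<open>v > 1\<close> can afford.\<close>
  have "L / pm \<le> L * sm"
    using H pm0 mult_left_mono[OF H, of L] form_abs_nonneg[of "of_int q0" "of_int_vec q"]
    by (simp add: L_def field_simps)
  also have "\<dots> \<le> sm powr (1 - v)" unfolding split using Lv sm1 by simp
  finally have Lpm: "L / pm \<le> sm powr (1 - v)" .
  have "sm powr (1 - v) < (d powr (1 / (1 - v))) powr (1 - v)"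
    using v d smd by (intro powr_less_mono2_neg) auto
  also have "\<dots> = d" using v d by (simp add: powr_powr)
  finally have Ld: "L / pm < d" using Lpm by linarith
  have "sm powr (1 - v) \<le> 1" using v sm1 powr_mono[of "1 - v" 0 sm] by simp
  then have "L / pm \<le> 1" using Lpm by linarith
  then have "L \<le> pm" using pm0 by (simp add: field_simps)
  then obtain m0 m where m: "supmax (of_int m0) (of_int_vec m) = K * (pm * sm)"
    "form_abs (of_int m0) (of_int_vec m) = L / (K * pm)"
    using resc[of "of_int q0" "of_int_vec q"] pm0 unfolding L_def pm_def sm_def by auto
  have "L > 0"
    using nonvanishing[OF q, of q0] form_abs_nonneg[of "of_int q0" "of_int_vec q"] by (simp add: L_def)
  then have pos: "L / (K * pm) > 0" using pm0 K by simp
  have le: "L / (K * pm) \<le> L / pm" using \<open>L > 0\<close> pm0 K by (intro divide_left_mono) auto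
  \<comment> \<open>Otherwise the rescaled vector has height at most \<open>K * B\<close>, and its
    positive value lies in \<open>V\<close> although it is below \<open>d\<close>.\<close>
  have "pm * sm > B"
  proof (rule ccontr)
    assume "\<not> pm * sm > B"
    then have "K * (pm * sm) \<le> K * B" using K by (intro mult_left_mono) auto
    then have "L / (K * pm) \<in> V"
      unfolding V_def using m pos by (auto intro!: image_eqI[of _ _ "(m0, m)"])
    then have "d \<le> L / (K * pm)" unfolding d_def using finV by (intro Min_le) auto
    then show False using le Ld by linarith
  qed
  then show ?thesis using sol unfolding pm_def sm_def by blast
qed

lemma w_exp_le: "w_exp p y \<le> wp_exp p y + 1"
  unfolding w_exp_def
proof (intro Sup_least, elim CollectE exE conjE, hypsubst)
  fix v :: real
  assume "infinite {(q0 :: int, q :: int ^ 'n). form_abs (of_int q0) (of_int_vec q)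
    \<le> supmax (of_int q0) (of_int_vec q) powr (- v)}"
  then have sol: "\<exists>q0 q. form_abs (of_int q0) (of_int_vec q)
        \<le> supmax (of_int q0) (of_int_vec q) powr (- v)
      \<and> supmax (of_int q0) (of_int_vec q) > M" for M
    unfolding infinite_iff_supmax_unbounded by blast
  show "ereal v \<le> wp_exp p y + 1"
  proof (cases "v > 1")
    case False
    then have "ereal v \<le> 0 + 1" by (simp add: one_ereal_def)
    also have "\<dots> \<le> wp_exp p y + 1" by (intro add_right_mono wp_exp_nonneg)
    finally show ?thesis .
  next
    case v: True
    show ?thesis
    proof (cases "\<exists>q0 q. q \<noteq> 0 \<and> form_abs (of_int q0) (of_int_vec q) = 0")
      case True
      then show ?thesis using wp_exp_eq_infinity by auto
    next
      case False
      then have nonvanishing: "form_abs (of_int q0) (of_int_vec q) \<noteq> 0" if "q \<noteq> 0" for q0 q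
        using that by blast
      have "ereal (v - 1) \<le> wp_exp p y"
      proof (rule ereal_le_epsilon2)
        fix e :: real
        assume e: "0 < e"
        \<comment> \<open>The loss of \<open>e\<close> turns the non-strict inequality of
          \<open>w_exp\<close> into the strict one of \<open>wp_exp\<close>.\<close>
        define u where "u = v - 1 - e"
        have "ereal u \<le> wp_exp p y"
        proof (rule wp_exp_ge)
          fix B :: real
          assume B: "B \<ge> 1"
          obtain q0 q where q: "form_abs (of_int q0) (of_int_vec q)
              \<le> supmax (of_int q0) (of_int_vec q) powr (- v)"
            "pmax p (of_int_vec q) * supmax (of_int q0) (of_int_vec q) > B"
            using solution_unbounded[OF v nonvanishing sol, of B] by blast
          define L where "L = form_abs (of_int q0) (of_int_vec q)"
          define sm where "sm = supmax (of_int q0) (of_int_vec q)"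
          define H where "H = pmax p (of_int_vec q) * sm"
          have H: "H > 1" using q(2) B by (simp add: H_def sm_def)
          have "H \<le> 1 * sm" unfolding H_def sm_def
            by (intro mult_right_mono pmax_of_int_vec_le_1 prime_p supmax_nonneg)
          then have Hs: "H \<le> sm" by simp
          have "L * sm \<le> sm powr (- v) * sm"
            using q(1) H Hs by (simp add: L_def sm_def)
          also have "\<dots> = sm powr (1 - v)" using H Hs powr_add[of sm "- v" 1] by simp
          \<comment> \<open>The exponent is negative, so passing from \<open>sm\<close> to the
            smaller \<open>H\<close> can only increase the power.\<close>
          also have "\<dots> \<le> H powr (1 - v)" using H Hs v by (intro powr_mono2') auto
          also have "\<dots> < H powr (- (v - 1 - e))" using H e by (intro powr_less_mono) auto
          finally have "L * sm < inverse (H powr u)" by (simp only: u_def powr_minus)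
          then have "L < 1 / (H powr u * sm)" using H Hs by (simp add: field_simps)
          with q(2) show "\<exists>q0\<in>Z_inv p. \<exists>q. (\<forall>i. q $ i \<in> Z_inv p) \<and> pmax p q * supmax q0 q > B \<and>
              form_abs q0 q < 1 / ((pmax p q * supmax q0 q) powr u * supmax q0 q)"
            unfolding L_def H_def sm_def
            by (intro bexI[of _ "of_int q0"] exI[of _ "of_int_vec q"]) auto
        qed
        then have "ereal u + ereal e \<le> wp_exp p y + ereal e" by (rule add_right_mono)
        then show "ereal (v - 1) \<le> wp_exp p y + ereal e" by (simp add: u_def)
      qed
      then have "ereal (v - 1) + 1 \<le> wp_exp p y + 1" by (rule add_right_mono)
      then show ?thesis by (simp add: one_ereal_def)
    qed
  qed
qed

section \<open>The inequality w_p + 1 \<le> w\<close>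

text \<open>With \<open>H\<close> the product of the two norms, dividing by \<open>pmax\<close>
  leaves a value below \<open>H powr (- (v + 1))\<close>, and rescaling realizes it up to a constant
  at an integer vector of height \<open>K * H\<close>. The constant costs an arbitrarily small part
  of the exponent.\<close>

lemma w_exp_ge_of_wp_solutions:
  assumes v: "v > 0"
    and solutions: "\<And>B. \<exists>q0\<in>Z_inv p. \<exists>q. (\<forall>i. q $ i \<in> Z_inv p) \<and> pmax p q * supmax q0 q > B \<and>
      form_abs q0 q < 1 / ((pmax p q * supmax q0 q) powr v * supmax q0 q)"
  shows "ereal (v + 1) \<le> w_exp p y"
proof (rule ereal_le_epsilon2)
  fix e' :: real
  assume e': "0 < e'"
  \<comment> \<open>The cap at 1 gives \<open>v' \<ge> v > 0\<close>, since \<open>w_exp\<close>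
    admits only positive exponents.\<close>
  define e where "e = min e' 1"
  have e: "e > 0" "e \<le> 1" "e \<le> e'" using e' by (auto simp: e_def)
  define v' where "v' = v + 1 - e"
  obtain K where K: "K \<ge> 1" and resc: "\<And>q0 q. q0 \<in> Z_inv p \<Longrightarrow> \<forall>i. q $ i \<in> Z_inv p \<Longrightarrow> pmax p q > 0 \<Longrightarrow>
      form_abs q0 q \<le> pmax p q \<Longrightarrow>
      \<exists>m0 m. supmax (of_int m0) (of_int_vec m) = K * (pmax p q * supmax q0 q) \<and>
        form_abs (of_int m0) (of_int_vec m) = form_abs q0 q / (K * pmax p q)"
    using integral_rescaling by blast
  have "ereal v' \<le> w_exp p y"
  proof (rule w_exp_ge)
    show "v' > 0" using v e by (simp add: v'_def)
    fix M
    \<comment> \<open>The bound \<open>K powr (v' / e)\<close> yields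
      \<open>K powr v' \<le> H powr e\<close>, so the spare factor \<open>H powr (- e)\<close>
      absorbs \<open>K\<close>.\<close>
    obtain q0 q where q: "q0 \<in> Z_inv p" "\<forall>i. q $ i \<in> Z_inv p"
      "pmax p q * supmax q0 q > max (max 1 M) (K powr (v' / e))"
      "form_abs q0 q < 1 / ((pmax p q * supmax q0 q) powr v * supmax q0 q)"
      using solutions by blast
    define L where "L = form_abs q0 q"
    define pm where "pm = pmax p q"
    define sm where "sm = supmax q0 q"
    define H where "H = pm * sm"
    have H: "H > 1" "H > M" "H > K powr (v' / e)" using q(3) by (auto simp: H_def pm_def sm_def)
    have nz: "pm \<noteq> 0" "sm \<noteq> 0" using H(1) by (auto simp: H_def)
    then have pos: "pm > 0" "sm > 0"
      using pmax_nonneg[of p q] supmax_nonneg[of q0 q] by (auto simp: pm_def sm_def)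
    have "L < 1 / (H powr v * sm)" using q(4) by (simp add: L_def H_def pm_def sm_def)
    then have "L / pm < 1 / (H powr v * H)"
      using pos H(1) by (simp add: H_def field_simps)
    also have "\<dots> = H powr (- (v + 1))"
      using H(1) powr_add[of H v 1] powr_minus[of H "v + 1"] by (simp add: field_simps)
    finally have Lpm: "L / pm < H powr (- (v + 1))" .
    also have "\<dots> \<le> H powr 0" using H(1) v by (intro powr_mono) auto
    finally have "L \<le> pm" using H(1) pos by (simp add: field_simps)
    then obtain m0 m where m: "supmax (of_int m0) (of_int_vec m) = K * H"
      "form_abs (of_int m0) (of_int_vec m) = L / (K * pm)"
      using resc[of q0 q] q(1,2) pos unfolding L_def pm_def sm_def H_def by auto
    have "M < 1 * H" using H(2) by simp
    also have "1 * H \<le> K * H" using H(1) K by (intro mult_right_mono) auto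
    finally have large: "M < K * H" .
    have "K powr v' = (K powr (v' / e)) powr e" using e by (simp add: powr_powr)
    also have "\<dots> \<le> H powr e" using H(3) e by (intro powr_mono2) auto
    finally have "H powr (- e) \<le> K powr (- v')"
      using H(1) K by (simp add: powr_minus le_imp_inverse_le)
    then have "H powr (- e) * H powr (- v') \<le> K powr (- v') * H powr (- v')"
      by (intro mult_right_mono) auto
    also have "\<dots> = (K * H) powr (- v')" using H(1) K by (simp add: powr_mult)
    also have "H powr (- e) * H powr (- v') = H powr (- (v + 1))"
      by (simp add: v'_def flip: powr_add)
    finally have "L / pm \<le> (K * H) powr (- v')" using Lpm by linarith
    moreover have "L / (K * pm) \<le> L / pm"
      using form_abs_nonneg[of q0 q] pos K by (intro divide_left_mono) (auto simp: L_def)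
    ultimately show "\<exists>q0 q. form_abs (of_int q0) (of_int_vec q)
          \<le> supmax (of_int q0) (of_int_vec q) powr (- v')
        \<and> supmax (of_int q0) (of_int_vec q) > M"
      using m large by (intro exI[of _ m0] exI[of _ m]) simp
  qed
  then have "ereal v' + ereal e \<le> w_exp p y + ereal e'"
    using e by (intro add_mono) auto
  then show "ereal (v + 1) \<le> w_exp p y + ereal e'" by (simp add: v'_def)
qed

text \<open>The 1 stands on the side of the bound so that \<open>Sup_least\<close> can treat each
  admissible \<open>v\<close> separately; nonpositive \<open>v\<close> are covered by
  \<open>one_le_w_exp\<close>.\<close>

lemma wp_exp_le: "wp_exp p y \<le> w_exp p y - 1"
  unfolding wp_exp_def
proof (intro Sup_least, elim CollectE exE conjE, hypsubst)
  fix v :: real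
  assume sol: "\<forall>B. \<exists>q0\<in>Z_inv p. \<exists>q :: rat ^ 'n. (\<forall>i. q $ i \<in> Z_inv p) \<and>
    pmax p q * supmax q0 q > B \<and>
    form_abs q0 q < 1 / ((pmax p q * supmax q0 q) powr v * supmax q0 q)"
  have "ereal (v + 1) \<le> w_exp p y"
  proof (cases "v > 0")
    case True
    then show ?thesis using sol by (intro w_exp_ge_of_wp_solutions) auto
  next
    case False
    then have "ereal (v + 1) \<le> 1" by (simp add: one_ereal_def)
    then show ?thesis using one_le_w_exp by (rule order_trans)
  qed
  then show "ereal v \<le> w_exp p y - 1"
    by (cases "w_exp p y") (auto simp: one_ereal_def)
qed

lemma w_exp_eq: "w_exp p y = wp_exp p y + 1"
proof (rule antisym[OF w_exp_le])
  have "wp_exp p y + 1 \<le> w_exp p y - 1 + 1" by (intro add_right_mono wp_exp_le)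
  \<comment> \<open>Subtracting and adding 1 cancel at infinite values as well.\<close>
  also have "\<dots> = w_exp p y" by (cases "w_exp p y") (auto simp: one_ereal_def)
  finally show "wp_exp p y + 1 \<le> w_exp p y" .
qed

end

theorem proposition3p1:
  fixes p :: nat and y :: "padic ^ 'n"
  assumes "prime p"
    and "\<And>i. y $ i \<in> carrier (Qp p)"
  shows "w_exp p y = wp_exp p y + 1"
proof -
  interpret padic_point p y by unfold_locales (rule assms)+
  show ?thesis by (rule w_exp_eq)
qed

end
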